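(* Let $X$ be an abstract state space, let $A,B$ be linear operators on $X$ satisfying Kato's conditions, and let $(V(t))_{t\ge 0}$, with generator $G$, be the associated perturbed (Kato) semigroup. Then $(V(t))_{t\ge0}$ is honest if and only if the operator $BR(\lambda,A)$ is mean ergodic for some $\lambda>0$. Moreover, $G=A+B$ if and only if $BR(\lambda,A)$ is uniformly ergodic (for some $\lambda>0$).
   Context: An abstract state space is a real ordered Banach space $X$ with closed generating positive cone $X_+$ ($X=X_+-X_+$) on which the norm is additive: $\|u+v\|=\|u\|+\|v\|$ for $u,v\in X_+$. $\Psi\in X^*$ is the linear functional with $\langle\Psi,u\rangle=\|u\|$ for $u\in X_+$. For an operator $A$, $D(A)_+=D(A)\cap X_+$ and $R(\lambda,A)=(\lambda-A)^{-1}$. An operator $T$ is substochastic if it is positive and $\|Tu\|\le\|u\|$ for $u\in X_+$; a semigroup is substochastic if each of its operators is. Kato's conditions on $A,B$ with $D(A)\subseteq D(B)\subseteq X$: (1) $A$ generates a substochastic $C_0$-semigroup; (2) $Bu\ge0$ for $u\in D(A)_+$; (3) $\langle\Psi,(A+B)u\rangle\le0$ for all $u\in D(A)_+$. Here $A+B$ has domain $D(A)$. Kato's Theorem (known): under these conditions there is an extension $G$ of $A+B$ generating a substochastic $C_0$-semigroup $(V(t))_{t\ge0}$ (the perturbed, or Kato, semigroup), with $R(\lambda,G)u=\sum_{k\ge0}R(\lambda,A)(BR(\lambda,A))^ku$ for $\lambda>0$, $u\in X$; it is the minimal substochastic $C_0$-semigroup whose generator extends $A+B$. Honesty: put $a(u)=-\langle\Psi,Au+Bu\rangle$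 for $u\in D(A)$ and define $\bar a:D(G)\to\mathbb R$ by $\bar a(R(\lambda,G)u)=\sum_{k\ge0}a\big(R(\lambda,A)(BR(\lambda,A))^ku\big)$, $u\in X$ (this is well defined and independent of $\lambda>0$). $(V(t))_{t\ge0}$ is honest if $\|V(t)u\|-\|u\|=-\bar a\big(\int_0^tV(s)u\,ds\big)$ for all $t\ge0$, $u\in X_+$; otherwise it is dishonest. A bounded operator $T$ is mean ergodic if the Cesàro means $\frac1n\sum_{k=0}^{n-1}T^k$ converge in the strong operator topology, and uniformly ergodic if they converge in operator norm. *)

theory Defs
  imports "HOL-Analysis.Analysis"
begin

class abstract_state_space = banach + ordered_real_vector +
  assumes closed_cone: "closed {u. 0 \<le> u}"
    and generating_cone: "\<exists>v w. 0 \<le> v \<and> 0 \<le> w \<and> u = v - w"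
    and norm_additive: "0 \<le> u \<Longrightarrow> 0 \<le> v \<Longrightarrow> norm (u + v) = norm u + norm v"

text \<open>The functional $\Psi \in X^*$ that agrees with the norm on the positive cone.\<close>

definition Psi :: "'a::abstract_state_space \<Rightarrow>\<^sub>L real" where
  "Psi = (THE f. \<forall>u\<ge>0. blinfun_apply f u = norm u)"

lemma Psi_unique_existence:
  "\<exists>!f :: 'a::abstract_state_space \<Rightarrow>\<^sub>L real. \<forall>u\<ge>0. blinfun_apply f u = norm u"
proof (rule ex_ex1I)
  have "\<forall>u::'a. \<exists>v w. 0 \<le> v \<and> 0 \<le> w \<and> u = v - w"
    using generating_cone by blast
  then obtain p q :: "'a \<Rightarrow> 'a"
    where pq: "0 \<le> p u" "0 \<le> q u" "u = p u - q u" for u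
    by metis
  define f where "f u = norm (p u) - norm (q u)" for u
  have f: "f (v - w) = norm v - norm w" if "0 \<le> v" "0 \<le> w" for v w
  proof -
    have "p (v - w) + w = v + q (v - w)"
      using pq(3)[of "v - w"] by (simp add: algebra_simps)
    then have "norm (p (v - w)) + norm w = norm v + norm (q (v - w))"
      using that pq by (metis norm_additive)
    then show ?thesis
      by (simp add: f_def)
  qed
  have add: "f (x + y) = f x + f y" for x y
  proof -
    have "x + y = (p x + p y) - (q x + q y)"
      using pq(3)[of x] pq(3)[of y] by (simp add: algebra_simps)
    then have "f (x + y) = norm (p x + p y) - norm (q x + q y)"
      using f[of "p x + p y" "q x + q y"] pq by simp
    then show ?thesis
      using pq by (simp add: f_def norm_additive)
  qed
  have scale: "f (c *\<^sub>R x) = c *\<^sub>R f x" for c x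
  proof (cases "0 \<le> c")
    case True
    have "c *\<^sub>R x = c *\<^sub>R p x - c *\<^sub>R q x"
      using pq(3)[of x] by (metis scaleR_diff_right)
    then show ?thesis
      using f[of "c *\<^sub>R p x" "c *\<^sub>R q x"] pq True
      by (simp add: f_def scaleR_nonneg_nonneg right_diff_distrib)
  next
    case False
    have "c *\<^sub>R x = (- c) *\<^sub>R q x - (- c) *\<^sub>R p x"
      using pq(3)[of x] by (metis minus_diff_minus scaleR_diff_right scaleR_minus_left add.commute
          diff_minus_eq_add uminus_add_conv_diff)
    moreover have "0 \<le> (- c) *\<^sub>R q x" "0 \<le> (- c) *\<^sub>R p x"
      using pq False by (auto intro!: scaleR_nonneg_nonneg simp del: scaleR_minus_left)
    ultimately have "f (c *\<^sub>R x) = norm ((- c) *\<^sub>R q x) - norm ((- c) *\<^sub>R p x)"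
      using f by metis
    then show ?thesis
      using False by (simp add: f_def algebra_simps)
  qed
  have bound: "norm (f u) \<le> norm u * 1" for u
    using norm_triangle_ineq3[of "p u" "q u"] pq(3)[of u] by (simp add: f_def)
  have "bounded_linear f"
    by (rule bounded_linear_intro[OF add scale bound])
  moreover have "f u = norm u" if "0 \<le> u" for u
    using f[of u 0] that by simp
  ultimately show "\<exists>f :: 'a \<Rightarrow>\<^sub>L real. \<forall>u\<ge>0. blinfun_apply f u = norm u"
    by (intro exI[of _ "Blinfun f"]) (simp add: bounded_linear_Blinfun_apply)
next
  fix f g :: "'a \<Rightarrow>\<^sub>L real"
  assume *: "\<forall>u\<ge>0. blinfun_apply f u = norm u" "\<forall>u\<ge>0. blinfun_apply g u = norm u"
  show "f = g"
  proof (rule blinfun_eqI)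
    fix u
    obtain v w :: 'a where "0 \<le> v" "0 \<le> w" "u = v - w"
      using generating_cone by blast
    then show "blinfun_apply f u = blinfun_apply g u"
      using * by (simp add: blinfun.diff_right)
  qed
qed

lemma Psi_nonneg: "0 \<le> u \<Longrightarrow> blinfun_apply Psi u = norm u"
  unfolding Psi_def using theI'[OF Psi_unique_existence] by blast

text \<open>
  An unbounded operator is given by its domain \<open>D\<close> and a function \<open>T\<close> whose values outside \<open>D\<close>
  are irrelevant.
\<close>

definition linear_operator :: "'a::real_vector set \<Rightarrow> ('a \<Rightarrow> 'a) \<Rightarrow> bool" where
  "linear_operator D T \<longleftrightarrow> subspace D \<and>
     (\<forall>u\<in>D. \<forall>v\<in>D. T (u + v) = T u + T v) \<and> (\<forall>c. \<forall>u\<in>D. T (c *\<^sub>R u) = c *\<^sub>R T u)"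

definition operator_extends ::
    "'a set \<Rightarrow> ('a \<Rightarrow> 'a) \<Rightarrow> 'a set \<Rightarrow> ('a \<Rightarrow> 'a) \<Rightarrow> bool" where
  "operator_extends E S D T \<longleftrightarrow> D \<subseteq> E \<and> (\<forall>u\<in>D. S u = T u)"

definition operator_eq ::
    "'a set \<Rightarrow> ('a \<Rightarrow> 'a) \<Rightarrow> 'a set \<Rightarrow> ('a \<Rightarrow> 'a) \<Rightarrow> bool" where
  "operator_eq E S D T \<longleftrightarrow> E = D \<and> (\<forall>u\<in>D. S u = T u)"

text \<open>$R(\lambda,T) = (\lambda - T)^{-1}$; meaningful when $\lambda - T$ maps \<open>D\<close> bijectively onto the space.\<close>

definition resolvent ::
    "'a::real_vector set \<Rightarrow> ('a \<Rightarrow> 'a) \<Rightarrow> real \<Rightarrow> 'a \<Rightarrow> 'a" where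
  "resolvent D T lam = inv_into D (\<lambda>u. lam *\<^sub>R u - T u)"

text \<open>Semigroups are indexed by \<open>real\<close>; their values at negative times are irrelevant.\<close>

definition C0_semigroup :: "(real \<Rightarrow> 'a::banach \<Rightarrow>\<^sub>L 'a) \<Rightarrow> bool" where
  "C0_semigroup V \<longleftrightarrow> V 0 = id_blinfun \<and>
     (\<forall>s\<ge>0. \<forall>t\<ge>0. V (s + t) = V s o\<^sub>L V t) \<and>
     (\<forall>u. ((\<lambda>t. V t u) \<longlongrightarrow> u) (at_right 0))"

definition is_generator ::
    "(real \<Rightarrow> 'a::banach \<Rightarrow>\<^sub>L 'a) \<Rightarrow> 'a set \<Rightarrow> ('a \<Rightarrow> 'a) \<Rightarrow> bool" where
  "is_generator V D T \<longleftrightarrow>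
     D = {u. \<exists>v. ((\<lambda>h. (1 / h) *\<^sub>R (V h u - u)) \<longlongrightarrow> v) (at_right 0)} \<and>
     (\<forall>u\<in>D. ((\<lambda>h. (1 / h) *\<^sub>R (V h u - u)) \<longlongrightarrow> T u) (at_right 0))"

definition substochastic :: "('a::abstract_state_space \<Rightarrow>\<^sub>L 'a) \<Rightarrow> bool" where
  "substochastic T \<longleftrightarrow> (\<forall>u\<ge>0. 0 \<le> blinfun_apply T u \<and> norm (blinfun_apply T u) \<le> norm u)"

definition substochastic_semigroup ::
    "(real \<Rightarrow> 'a::abstract_state_space \<Rightarrow>\<^sub>L 'a) \<Rightarrow> bool" where
  "substochastic_semigroup V \<longleftrightarrow> C0_semigroup V \<and> (\<forall>t\<ge>0. substochastic (V t))"

definition kato_conditions ::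
    "'a::abstract_state_space set \<Rightarrow> ('a \<Rightarrow> 'a) \<Rightarrow> 'a set \<Rightarrow> ('a \<Rightarrow> 'a) \<Rightarrow> bool" where
  "kato_conditions DA A DB B \<longleftrightarrow>
     linear_operator DA A \<and> linear_operator DB B \<and> DA \<subseteq> DB \<and>
     (\<exists>S. substochastic_semigroup S \<and> is_generator S DA A) \<and>
     (\<forall>u\<in>DA. 0 \<le> u \<longrightarrow> 0 \<le> B u) \<and>
     (\<forall>u\<in>DA. 0 \<le> u \<longrightarrow> blinfun_apply Psi (A u + B u) \<le> 0)"

text \<open>The $k$-th term $R(\lambda,A)(BR(\lambda,A))^k u$ of the resolvent series.\<close>

definition kato_term ::
    "'a::real_vector set \<Rightarrow> ('a \<Rightarrow> 'a) \<Rightarrow> ('a \<Rightarrow> 'a) \<Rightarrow> real \<Rightarrow> nat \<Rightarrow> 'a \<Rightarrow> 'a" where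
  "kato_term DA A B lam k u =
     resolvent DA A lam (((\<lambda>w. B (resolvent DA A lam w)) ^^ k) u)"

text \<open>
  \<open>V\<close> is the semigroup, with generator \<open>G\<close> on \<open>DG\<close>, provided by Kato's theorem. The resolvent
  formula determines it uniquely; its minimality among the substochastic semigroups whose generator
  extends $A + B$ is then a consequence and is not repeated as a requirement.
\<close>

definition kato_semigroup ::
    "'a::abstract_state_space set \<Rightarrow> ('a \<Rightarrow> 'a) \<Rightarrow> ('a \<Rightarrow> 'a) \<Rightarrow>
     (real \<Rightarrow> 'a \<Rightarrow>\<^sub>L 'a) \<Rightarrow> 'a set \<Rightarrow> ('a \<Rightarrow> 'a) \<Rightarrow> bool" where
  "kato_semigroup DA A B V DG G \<longleftrightarrow>
     substochastic_semigroup V \<and> is_generator V DG G \<and>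
     operator_extends DG G DA (\<lambda>u. A u + B u) \<and>
     (\<forall>lam>0. \<forall>u. (\<lambda>k. kato_term DA A B lam k u) sums resolvent DG G lam u)"

definition a_functional ::
    "('a::abstract_state_space \<Rightarrow> 'a) \<Rightarrow> ('a \<Rightarrow> 'a) \<Rightarrow> 'a \<Rightarrow> real" where
  "a_functional A B u = - blinfun_apply Psi (A u + B u)"

text \<open>
  $\bar a(R(\lambda,G)u) = \sum_k a(R(\lambda,A)(BR(\lambda,A))^k u)$; the description picks the
  common value of the series over all representations $v = R(\lambda,G)u$ with $\lambda > 0$.
\<close>

definition abar ::
    "'a::abstract_state_space set \<Rightarrow> ('a \<Rightarrow> 'a) \<Rightarrow> ('a \<Rightarrow> 'a) \<Rightarrow>
     'a set \<Rightarrow> ('a \<Rightarrow> 'a) \<Rightarrow> 'a \<Rightarrow> real" where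
  "abar DA A B DG G v =
     (THE r. \<forall>lam>0. \<forall>u. resolvent DG G lam u = v \<longrightarrow>
        (\<lambda>k. a_functional A B (kato_term DA A B lam k u)) sums r)"

definition honest ::
    "'a::abstract_state_space set \<Rightarrow> ('a \<Rightarrow> 'a) \<Rightarrow> ('a \<Rightarrow> 'a) \<Rightarrow>
     (real \<Rightarrow> 'a \<Rightarrow>\<^sub>L 'a) \<Rightarrow> 'a set \<Rightarrow> ('a \<Rightarrow> 'a) \<Rightarrow> bool" where
  "honest DA A B V DG G \<longleftrightarrow>
     (\<forall>t\<ge>0. \<forall>u\<ge>0. norm (V t u) - norm u = - abar DA A B DG G (integral {0..t} (\<lambda>s. V s u)))"

definition cesaro_mean :: "('a::real_normed_vector \<Rightarrow>\<^sub>L 'a) \<Rightarrow> nat \<Rightarrow> 'a \<Rightarrow>\<^sub>L 'a" where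
  "cesaro_mean T n = (1 / real n) *\<^sub>R (\<Sum>k<n. (((o\<^sub>L) T) ^^ k) id_blinfun)"

definition mean_ergodic :: "('a::real_normed_vector \<Rightarrow> 'a) \<Rightarrow> bool" where
  "mean_ergodic T \<longleftrightarrow> bounded_linear T \<and>
     (\<exists>P. limitin strong_operator_topology (cesaro_mean (Blinfun T)) P sequentially)"

definition uniformly_ergodic :: "('a::real_normed_vector \<Rightarrow> 'a) \<Rightarrow> bool" where
  "uniformly_ergodic T \<longleftrightarrow> bounded_linear T \<and> convergent (cesaro_mean (Blinfun T))"

end

theory Submission
  imports Defs
begin

text \<open>
  Put $K = BR(\lambda,A)$, a positive operator that is contractive on $X_+$, and
  $\beta_\lambda(u) = \lim_n \langle\Psi, K^n u\rangle$. Telescoping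
  $\langle\Psi, Ku\rangle = \langle\Psi, u\rangle - \lambda\langle\Psi, R(\lambda,A)u\rangle - a(R(\lambda,A)u)$
  along the powers of $K$ yields $\bar a(v) = -\langle\Psi, Gv\rangle - \beta_\lambda((\lambda - G)v)$ on $D(G)$,
  so that the semigroup is honest iff $\beta_\lambda((\lambda - G)v) = 0$ for all $v = \int_0^t V(s)u\,ds$
  with $u \in X_+$. For such $v$ this says
  $\beta_\lambda(V(t)u) = \beta_\lambda(u) + \lambda\int_0^t \beta_\lambda(V(s)u)\,ds$,
  and boundedness in $t$ forces $\beta_\lambda = 0$. As $\beta_\lambda(u)$ is the limit of the norms
  $\|K^n u\|$ for $u \ge 0$, honesty amounts to $K^n \to 0$ strongly. Finally $K$ has no nonzero fixed
  point, because for $Kv = v$ the terms of the convergent series $R(\lambda,G)v$ are all $R(\lambda,A)v$,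
  so the Cesaro means of $K$ can only converge to $0$.

  For the second equivalence, $G = A + B$ iff $I - K$ is surjective. Then the open mapping theorem bounds
  $(I - K)^{-1}$, and the Cesaro means $C_n$ satisfy $(I - K)C_n = \frac1n(I - K^n)$. Conversely
  $\|C_n\| < 1$ makes $I - C_n = (I - K)Q_n$ surjective.
\<close>

section \<open>An open mapping theorem for cones\<close>

text \<open>By Baire, the closure of the image of some \<open>P \<inter> cball 0 n\<close> contains
  a ball around a point \<open>y0\<close>. Adding a preimage of \<open>- y0\<close> from
  \<open>P\<close> recentres this ball at 0; no differences are formed, because \<open>P\<close> may
  be a cone.\<close>

lemma surj_closure_image_contains_ball:
  fixes T :: "'a::banach \<Rightarrow> 'b::banach"
  assumes T: "bounded_linear T"
    and add: "\<And>x y. x \<in> P \<Longrightarrow> y \<in> P \<Longrightarrow> x + y \<in> P"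
    and surj: "\<And>y. \<exists>x\<in>P. T x = y"
  shows "\<exists>N>0. \<exists>r>0. ball 0 r \<subseteq> closure (T ` (P \<inter> cball 0 N))"
proof -
  interpret T: bounded_linear T by fact
  define C where "C n = T ` (P \<inter> cball 0 (real n))" for n
  have "\<Union> (range (\<lambda>n. closure (C n))) = UNIV"
  proof -
    have "y \<in> (\<Union>n. closure (C n))" for y
    proof -
      obtain x where x: "x \<in> P" "T x = y"
        using surj by blast
      obtain n where "norm x \<le> real n"
        using real_arch_simple by blast
      then have "y \<in> C n"
        unfolding C_def using x by auto
      then show ?thesis
        using closure_subset by blast
    qed
    then show ?thesis by auto
  qed
  moreover have "interior (\<Union> (range (\<lambda>n. closure (C n)))) = {}"
    if "\<And>n. interior (closure (C n)) = {}"
  proof -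
    have "euclidean interior_of \<Union> (range (\<lambda>n. closure (C n))) = {}"
      by (rule Baire_category_alt[OF disjI1[OF completely_metrizable_space_euclidean]]) (use that in auto)
    then show ?thesis by simp
  qed
  ultimately obtain n where "interior (closure (C n)) \<noteq> {}"
    by fastforce
  then obtain y0 r where r: "r > 0" "ball y0 r \<subseteq> closure (C n)"
    by (metis ex_in_conv mem_interior)
  obtain x1 where x1: "x1 \<in> P" "T x1 = - y0"
    using surj by blast
  \<comment> \<open>The shift costs \<open>norm x1\<close> in the radius; the summand 1 makes
    \<open>N\<close> positive.\<close>
  define N where "N = real n + norm x1 + 1"
  have "y \<in> closure (T ` (P \<inter> cball 0 N))" if "y \<in> ball 0 r" for y
  proof -
    have "y0 + y \<in> closure (C n)"
      using that r by (auto simp: dist_norm)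
    then have "y \<in> (+) (- y0) ` closure (C n)"
      by (metis add_minus_cancel imageI)
    also have "\<dots> = closure ((+) (- y0) ` C n)"
      by (rule closure_translation[symmetric])
    also have "\<dots> \<subseteq> closure (T ` (P \<inter> cball 0 N))"
    proof (rule closure_mono, clarsimp simp: C_def)
      fix x assume x: "x \<in> P" "norm x \<le> real n"
      have "T (x1 + x) = T x - y0"
        using x1 by (simp add: T.add)
      moreover have "x1 + x \<in> P \<inter> cball 0 N"
        using x x1 add norm_triangle_ineq[of x1 x] by (auto simp: N_def)
      ultimately show "T x - y0 \<in> T ` (P \<inter> cball 0 N)"
        by (metis imageI)
    qed
    finally show ?thesis .
  qed
  moreover have "N > 0"
    by (simp add: N_def add_nonneg_pos)
  ultimately show ?thesis
    using r(1) by blast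
qed

text \<open>\<open>P = UNIV\<close> is Banach's open mapping theorem; $P = X_+ \times X_+$ with
  $(v,w) \mapsto v - w$ gives decompositions $u = v - w$ with a norm bound.\<close>

lemma cone_open_mapping:
  fixes T :: "'a::banach \<Rightarrow> 'b::banach"
  assumes T: "bounded_linear T"
    and clo: "closed P"
    and add: "\<And>x y. x \<in> P \<Longrightarrow> y \<in> P \<Longrightarrow> x + y \<in> P"
    and scale: "\<And>c x. 0 \<le> c \<Longrightarrow> x \<in> P \<Longrightarrow> c *\<^sub>R x \<in> P"
    and surj: "\<And>y. \<exists>x\<in>P. T x = y"
  shows "\<exists>M>0. \<forall>y. \<exists>x\<in>P. T x = y \<and> norm x \<le> M * norm y"
proof -
  interpret T: bounded_linear T by fact
  obtain N r where N: "N > 0" and r: "r > 0"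
    and sub: "ball 0 r \<subseteq> closure (T ` (P \<inter> cball 0 N))"
    using surj_closure_image_contains_ball[OF T add surj] by blast
  define c where "c = 2 * N / r"
  have c: "c > 0"
    using N r by (simp add: c_def)
  have zero: "0 \<in> P"
    using surj[of 0] scale[of 0] by force
  have approx: "\<exists>x\<in>P. norm x \<le> c * norm y \<and> norm (y - T x) \<le> norm y / 2" for y
  proof (cases "y = 0")
    case True
    then show ?thesis
      using zero by (auto intro!: bexI[of _ 0] simp: T.zero)
  next
    case False
    \<comment> \<open>Dividing by \<open>s\<close> gives \<open>y\<close> norm \<open>r / 2\<close>,
      inside the ball. Scaling back turns the error \<open>r / 4\<close> into
      \<open>norm y / 2\<close> and the bound \<open>N\<close> into
      \<open>s * N = c * norm y\<close>.\<close>
    define s where "s = 2 * norm y / r"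
    have s: "s > 0"
      using False r by (simp add: s_def)
    have "(1 / s) *\<^sub>R y \<in> ball 0 r"
      using False r by (simp add: s_def)
    then have "(1 / s) *\<^sub>R y \<in> closure (T ` (P \<inter> cball 0 N))"
      using sub by blast
    moreover have "0 < r / 4"
      using r by simp
    ultimately obtain x where "x \<in> P \<inter> cball 0 N" "dist (T x) ((1 / s) *\<^sub>R y) < r / 4"
      unfolding closure_approachable by blast
    then have x: "x \<in> P" "norm x \<le> N" "dist (T x) ((1 / s) *\<^sub>R y) < r / 4"
      by auto
    have "norm (y - T (s *\<^sub>R x)) = s * dist (T x) ((1 / s) *\<^sub>R y)"
    proof -
      have "y - T (s *\<^sub>R x) = s *\<^sub>R ((1 / s) *\<^sub>R y - T x)"
        using s by (simp add: T.scaleR algebra_simps)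
      then show ?thesis
        using s by (simp add: dist_norm norm_minus_commute)
    qed
    also have "\<dots> \<le> s * (r / 4)"
      using x(3) s by (intro mult_left_mono) auto
    also have "\<dots> = norm y / 2"
      using r by (simp add: s_def)
    finally have "norm (y - T (s *\<^sub>R x)) \<le> norm y / 2" .
    moreover have "norm (s *\<^sub>R x) \<le> c * norm y"
    proof -
      have "norm (s *\<^sub>R x) \<le> s * N"
        using x(2) s by simp
      then show ?thesis
        by (simp add: s_def c_def ac_simps)
    qed
    ultimately show ?thesis
      using scale[OF less_imp_le[OF s] x(1)] by blast
  qed
  then obtain g where g: "\<And>y. g y \<in> P" "\<And>y. norm (g y) \<le> c * norm y"
      "\<And>y. norm (y - T (g y)) \<le> norm y / 2"
    by metis
  have "\<exists>x\<in>P. T x = y \<and> norm x \<le> 2 * c * norm y" for y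
  proof -
    \<comment> \<open>\<open>z n\<close> is the residual after \<open>n\<close> corrections. It
      halves each time, so the corrections \<open>g (z n)\<close> sum to an exact preimage, which
      stays in \<open>P\<close> because \<open>P\<close> is closed.\<close>
    define z where "z n = ((\<lambda>y. y - T (g y)) ^^ n) y" for n
    have z_Suc: "z (Suc n) = z n - T (g (z n))" for n
      by (simp add: z_def)
    have z: "norm (z n) \<le> norm y * (1 / 2) ^ n" for n
    proof (induction n)
      case (Suc n)
      then show ?case
        using g(3)[of "z n"] by (simp add: z_Suc)
    qed (simp add: z_def)
    have gz: "norm (g (z n)) \<le> c * norm y * (1 / 2) ^ n" for n
    proof -
      have "c * norm (z n) \<le> c * (norm y * (1 / 2) ^ n)"
        using z[of n] c by (intro mult_left_mono) auto
      then show ?thesis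
        using g(2)[of "z n"] by simp
    qed
    have geo: "(\<lambda>n. c * norm y * (1 / 2) ^ n) sums (2 * c * norm y)"
      using sums_mult[OF geometric_sums[of "1 / 2 :: real"], of "c * norm y"] by (simp add: ac_simps)
    have summ: "summable (\<lambda>n. g (z n))"
      using gz by (intro summable_comparison_test'[OF sums_summable[OF geo]]) auto
    have part: "(\<Sum>k<n. g (z k)) \<in> P" for n
      by (induction n) (auto simp: zero g intro: add)
    have "suminf (\<lambda>n. g (z n)) \<in> P"
      using closed_sequentially[OF clo part summable_LIMSEQ[OF summ]] .
    moreover have "norm (suminf (\<lambda>n. g (z n))) \<le> 2 * c * norm y"
    proof -
      have "norm (suminf (\<lambda>n. g (z n))) \<le> (\<Sum>n. c * norm y * (1 / 2) ^ n)"
        using gz sums_summable[OF geo] by (intro norm_suminf_le) auto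
      then show ?thesis
        using geo by (simp add: sums_iff)
    qed
    moreover have "T (suminf (\<lambda>n. g (z n))) = y"
    proof -
      have "(\<lambda>n. T (g (z n))) sums T (suminf (\<lambda>n. g (z n)))"
        using T.sums[OF summable_sums[OF summ]] .
      moreover have "z \<longlonglongrightarrow> 0"
      proof (rule Lim_null_comparison)
        show "\<forall>\<^sub>F n in sequentially. norm (z n) \<le> norm y * (1 / 2) ^ n"
          using z by simp
        show "(\<lambda>n. norm y * (1 / 2) ^ n) \<longlonglongrightarrow> 0"
          by (intro tendsto_mult_right_zero LIMSEQ_power_zero) auto
      qed
      then have "(\<lambda>n. z n - z (Suc n)) sums (z 0 - 0)"
        by (rule telescope_sums')
      then have "(\<lambda>n. T (g (z n))) sums y"
        by (simp add: z_Suc) (simp add: z_def)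
      ultimately show ?thesis
        by (rule sums_unique2)
    qed
    ultimately show ?thesis by blast
  qed
  then show ?thesis
    using c by (intro exI[of _ "2 * c"]) auto
qed

lemma bounded_decomposition:
  "\<exists>M>0. \<forall>u :: 'a::abstract_state_space.
     \<exists>v w. 0 \<le> v \<and> 0 \<le> w \<and> u = v - w \<and> norm v + norm w \<le> M * norm u"
proof -
  let ?P = "{u::'a. 0 \<le> u} \<times> {u::'a. 0 \<le> u}"
  have "\<exists>M>0. \<forall>u. \<exists>x\<in>?P. (\<lambda>(v, w). v - w) x = u \<and> norm x \<le> M * norm u"
  proof (rule cone_open_mapping)
    show "bounded_linear (\<lambda>x::'a \<times> 'a. case x of (v, w) \<Rightarrow> v - w)"
      using bounded_linear_sub[OF bounded_linear_fst bounded_linear_snd]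
      by (simp add: case_prod_beta)
    show "closed ?P"
      by (intro closed_Times closed_cone)
    show "\<exists>x\<in>?P. (\<lambda>(v, w). v - w) x = u" for u :: 'a
      using generating_cone[of u] by fastforce
  qed (auto intro!: scaleR_nonneg_nonneg)
  then obtain M where M: "M > 0" "\<And>u. \<exists>x\<in>?P. (\<lambda>(v, w). v - w) x = u \<and> norm x \<le> M * norm u"
    by blast
  \<comment> \<open>The norm of a pair dominates each of its components, hence the factor 2.\<close>
  have "\<exists>v w. 0 \<le> v \<and> 0 \<le> w \<and> u = v - w \<and> norm v + norm w \<le> 2 * M * norm u" for u :: 'a
  proof -
    obtain v w where "0 \<le> v" "0 \<le> w" "u = v - w" "norm (v, w) \<le> M * norm u"
      using M(2)[of u] by auto
    then show ?thesis
      using norm_fst_le[of v w] norm_snd_le[of w v] by force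
  qed
  then show ?thesis
    using M(1) by (intro exI[of _ "2 * M"]) simp
qed

text \<open>A contraction on the cone need not be one on the whole space. The constant
  \<open>M\<close> is chosen before \<open>T\<close>, so that one bound serves all
  \<open>V t\<close>, and another all powers of $BR(lam,A)$.\<close>

lemma cone_contractive_bound:
  "\<exists>M>0. \<forall>(T :: 'a::abstract_state_space \<Rightarrow> 'b::real_normed_vector) u.
     linear T \<longrightarrow> (\<forall>v\<ge>0. norm (T v) \<le> norm v) \<longrightarrow> norm (T u) \<le> M * norm u"
proof -
  obtain M :: real where M: "M > 0"
    "\<And>u::'a. \<exists>v w. 0 \<le> v \<and> 0 \<le> w \<and> u = v - w \<and> norm v + norm w \<le> M * norm u"
    using bounded_decomposition[where 'a='a] by auto
  have "norm (T u) \<le> M * norm u"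
    if "linear T" and T: "\<And>v. 0 \<le> v \<Longrightarrow> norm (T v) \<le> norm v"
    for T :: "'a \<Rightarrow> 'b" and u
  proof -
    obtain v w where vw: "0 \<le> v" "0 \<le> w" "u = v - w" "norm v + norm w \<le> M * norm u"
      using M(2)[of u] by blast
    have "norm (T u) \<le> norm (T v) + norm (T w)"
      using vw(3) \<open>linear T\<close> by (simp add: linear_diff norm_triangle_ineq4)
    also have "\<dots> \<le> M * norm u"
      using T[OF vw(1)] T[OF vw(2)] vw(4) by linarith
    finally show ?thesis .
  qed
  then show ?thesis
    using M(1) by blast
qed

section \<open>Positivity of limits and integrals\<close>

lemma nonneg_LIMSEQ:
  fixes f :: "nat \<Rightarrow> 'a::abstract_state_space"
  assumes "f \<longlonglongrightarrow> l" "\<And>n. 0 \<le> f n"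
  shows "0 \<le> l"
  using closed_sequentially[OF closed_cone, of f l] assms by simp

text \<open>Riemann sums over fine tagged divisions have nonnegative weights, so they lie in the
  cone; the integral is a limit of them and the cone is closed.\<close>

lemma has_integral_nonneg_cone:
  fixes f :: "real \<Rightarrow> 'a::abstract_state_space"
  assumes "(f has_integral I) {a..b}" and "\<And>s. s \<in> {a..b} \<Longrightarrow> 0 \<le> f s"
  shows "0 \<le> I"
proof -
  have "I \<in> closure {u. 0 \<le> u}"
    unfolding closure_approachable
  proof (intro allI impI)
    fix e :: real assume "e > 0"
    have "\<exists>\<gamma>. gauge \<gamma> \<and> (\<forall>\<D>. \<D> tagged_division_of {a..b} \<and> \<gamma> fine \<D> \<longrightarrow>
        norm ((\<Sum>(x, k)\<in>\<D>. measure lborel k *\<^sub>R f x) - I) < e)"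
      by (rule assms(1)[unfolded has_integral_real, rule_format, OF \<open>e > 0\<close>])
    then obtain \<gamma> where \<gamma>: "gauge \<gamma>"
      "\<And>\<D>. \<D> tagged_division_of {a..b} \<Longrightarrow> \<gamma> fine \<D> \<Longrightarrow>
         norm ((\<Sum>(x, k)\<in>\<D>. measure lborel k *\<^sub>R f x) - I) < e"
      by (elim exE conjE) simp
    obtain \<D> where \<D>: "\<D> tagged_division_of {a..b}" "\<gamma> fine \<D>"
      using fine_division_exists_real[OF \<gamma>(1)] by blast
    have "0 \<le> (\<Sum>(x, k)\<in>\<D>. measure lborel k *\<^sub>R f x)"
    proof (rule sum_nonneg, clarsimp)
      fix x k assume "(x, k) \<in> \<D>"
      then have "x \<in> {a..b}"
        using tag_in_interval[OF \<D>(1)[folded box_real]] by (auto simp: box_real)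
      then show "0 \<le> measure lborel k *\<^sub>R f x"
        using assms(2) by (intro scaleR_nonneg_nonneg) auto
    qed
    then show "\<exists>y\<in>{u. 0 \<le> u}. dist y I < e"
      using \<gamma>(2)[OF \<D>] by (auto simp: dist_norm)
  qed
  then show ?thesis
    by (simp add: closure_closed closed_cone)
qed

section \<open>Bounded semigroups\<close>

text \<open>A general bound \<open>M\<close> is allowed because substochastic semigroups are
  contractive only on the cone. The locale is applied to $V$ itself and to its rescalings $exp(-lam
  t) V(t)$.\<close>

locale bounded_C0_semigroup =
  fixes W :: "real \<Rightarrow> 'a::banach \<Rightarrow>\<^sub>L 'a" and M :: real
  assumes C0: "C0_semigroup W"
    and bound: "0 \<le> t \<Longrightarrow> norm (W t u) \<le> M * norm u"
    and M_pos: "M > 0"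
begin

lemma W_0: "W 0 u = u"
  using C0 by (simp add: C0_semigroup_def)

lemma W_add: "0 \<le> s \<Longrightarrow> 0 \<le> t \<Longrightarrow> W (s + t) u = W s (W t u)"
  using C0 by (simp add: C0_semigroup_def)

lemma W_commute: "0 \<le> s \<Longrightarrow> 0 \<le> t \<Longrightarrow> W s (W t u) = W t (W s u)"
  using W_add[of s t u] W_add[of t s u] by (simp add: add.commute)

lemma W_at_0: "((\<lambda>t. W t u) \<longlongrightarrow> u) (at_right 0)"
  using C0 by (simp add: C0_semigroup_def)

text \<open>Factoring out the operator at the smaller time reduces continuity from both sides at any
  time to right continuity at 0.\<close>

lemma W_diff_bound:
  assumes "0 \<le> s" "0 \<le> t"
  shows "norm (W t u - W s u) \<le> M * norm (W \<bar>t - s\<bar> u - u)"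
proof -
  have *: "norm (W t u - W s u) \<le> M * norm (W (t - s) u - u)" if "0 \<le> s" "s \<le> t" for s t
  proof -
    have "W t u - W s u = W s (W (t - s) u - u)"
      using W_add[of s "t - s" u] that by (simp add: blinfun.diff_right)
    then show ?thesis
      using bound[OF that(1)] by simp
  qed
  show ?thesis
    using *[of s t] *[of t s] assms by (cases "s \<le> t") (auto simp: norm_minus_commute)
qed

lemma continuous_on_W: "continuous_on {0..} (\<lambda>t. W t u)"
  unfolding continuous_on_iff
proof (intro ballI allI impI)
  fix s e :: real assume s: "s \<in> {0..}" and e: "0 < e"
  have "\<forall>\<^sub>F h in at_right 0. dist (W h u) u < e / M"
    using tendstoD[OF W_at_0[of u], of "e / M"] e M_pos by simp
  then obtain d where d: "d > 0" "\<And>h. 0 < h \<Longrightarrow> h < d \<Longrightarrow> dist (W h u) u < e / M"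
    unfolding eventually_at_right_field by auto
  have "dist (W t u) (W s u) < e" if "t \<in> {0..}" "dist t s < d" for t
  proof (cases "t = s")
    case False
    then have "norm (W \<bar>t - s\<bar> u - u) < e / M"
      using d(2)[of "\<bar>t - s\<bar>"] that by (simp add: dist_norm)
    then have "M * norm (W \<bar>t - s\<bar> u - u) < e"
      using M_pos by (simp add: field_simps)
    then show ?thesis
      using W_diff_bound[of s t u] s that by (simp add: dist_norm)
  qed (use e in simp)
  then show "\<exists>d>0. \<forall>t\<in>{0..}. dist t s < d \<longrightarrow> dist (W t u) (W s u) < e"
    using d(1) by blast
qed

section \<open>The integrated semigroup and the generator\<close>

definition J :: "real \<Rightarrow> 'a \<Rightarrow> 'a" where
  "J t u = integral {0..t} (\<lambda>s. W s u)"

lemma integrable_W: "0 \<le> a \<Longrightarrow> (\<lambda>s. W s u) integrable_on {a..b}"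
  by (intro integrable_continuous_real continuous_on_subset[OF continuous_on_W]) auto

lemma J_has_integral: "((\<lambda>s. W s u) has_integral J t u) {0..t}"
  unfolding J_def by (intro integrable_integral integrable_W) simp

lemma linear_J: "linear (J t)"
  by (rule linearI)
    (auto simp: J_def blinfun.add_right blinfun.scaleR_right intro!: integral_add integrable_W)

lemma norm_J: "0 \<le> t \<Longrightarrow> norm (J t u) \<le> M * t * norm u"
  using has_integral_bound_real[OF _ finite.emptyI J_has_integral[of u t], of "M * norm u"] bound M_pos
  by (simp add: ac_simps)

lemma bounded_linear_J: "0 \<le> t \<Longrightarrow> bounded_linear (J t)"
  using linear_J[of t] norm_J[of t]
  by (intro bounded_linear_intro[of _ "M * t"]) (auto simp: linear_add linear_scale ac_simps)

lemma J_commute: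
  assumes "0 \<le> h" "0 \<le> t"
  shows "J t (W h u - u) = W h (J t u) - J t u"
proof -
  have "W h (J t u) = integral {0..t} (\<lambda>s. W h (W s u))"
    unfolding J_def
    using integral_linear[OF integrable_W[of 0 u t] blinfun.bounded_linear_right[of "W h"]]
    by (simp add: o_def)
  also have "\<dots> = integral {0..t} (\<lambda>s. W s (W h u))"
    using assms by (intro integral_cong) (simp add: W_commute[of h])
  also have "\<dots> = J t (W h u)"
    by (simp add: J_def)
  finally show ?thesis
    using linear_J by (simp add: linear_diff)
qed

lemma J_quotient: "((\<lambda>h. (1 / h) *\<^sub>R J h v) \<longlongrightarrow> v) (at_right 0)"
proof -
  \<comment> \<open>The fundamental theorem of calculus at the left end point, where the integrand
    is \<open>W 0 v = v\<close>.\<close>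
  have "((\<lambda>t. J t v) has_vector_derivative W 0 v) (at 0 within {0..1})"
    unfolding J_def
    by (rule integral_has_vector_derivative)
       (auto intro: continuous_on_subset[OF continuous_on_W])
  then have "((\<lambda>h. norm (J h v - h *\<^sub>R v) / norm h) \<longlongrightarrow> 0) (at_right 0)"
    by (simp add: has_vector_derivative_def has_derivative_iff_norm W_0 at_within_Icc_at_right)
      (simp add: J_def)
  then have "((\<lambda>h. norm ((1 / h) *\<^sub>R J h v - v)) \<longlongrightarrow> 0) (at_right 0)"
  proof (rule Lim_transform_eventually)
    have "norm (J h v - h *\<^sub>R v) / norm h = norm ((1 / h) *\<^sub>R J h v - v)" if "0 < h" for h
    proof -
      have "(1 / h) *\<^sub>R J h v - v = (1 / h) *\<^sub>R (J h v - h *\<^sub>R v)"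
        using that by (simp add: scaleR_diff_right)
      then show ?thesis
        using that by simp
    qed
    then show "\<forall>\<^sub>F h in at_right 0. norm (J h v - h *\<^sub>R v) / norm h = norm ((1 / h) *\<^sub>R J h v - v)"
      by (auto simp: eventually_at_right_field intro!: exI[of _ 1])
  qed
  then show ?thesis
    by (simp add: tendsto_norm_zero_iff LIM_zero_iff)
qed

lemma J_shift:
  assumes "0 \<le> h" "0 \<le> t"
  shows "W h (J t u) - J t u = J h (W t u - u)"
proof -
  \<comment> \<open>Both sides are the integral over \<open>{0..h + t}\<close>, split at
    \<open>h\<close> on the left and at \<open>t\<close> on the right.\<close>
  have "J t (W h u) + J h u = J h (W t u) + J t u"
  proof -
    have *: "J s (W r u) + J r u = J (r + s) u" if "0 \<le> r" "0 \<le> s" for r s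
    proof -
      have "J s (W r u) = integral {0..s} ((\<lambda>x. W x u) \<circ> (+) r)"
        unfolding J_def using that by (intro integral_cong) (simp add: W_add W_commute[of r])
      also have "\<dots> = integral {r..r + s} (\<lambda>x. W x u)"
        by (simp add: integral_shift_Icc_real add.commute)
      finally show ?thesis
        using Henstock_Kurzweil_Integration.integral_combine[of 0 r "r + s" "\<lambda>x. W x u"] that integrable_W[of 0]
        by (simp add: J_def add.commute)
    qed
    show ?thesis
      using *[of h t] *[of t h] assms by (simp add: add.commute)
  qed
  then show ?thesis
    using J_commute[OF assms] linear_J by (simp add: linear_diff algebra_simps)
qed

lemma generator_J:
  assumes "0 \<le> t"
  shows "((\<lambda>h. (1 / h) *\<^sub>R (W h (J t u) - J t u)) \<longlongrightarrow> W t u - u) (at_right 0)"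
proof (rule Lim_transform_eventually[OF J_quotient])
  show "\<forall>\<^sub>F h in at_right 0. (1 / h) *\<^sub>R J h (W t u - u) = (1 / h) *\<^sub>R (W h (J t u) - J t u)"
    using J_shift assms by (auto simp: eventually_at_right_field intro!: exI[of _ 1])
qed

text \<open>By \<open>J_commute\<close>, applying \<open>J t\<close> to the difference quotients of
  \<open>u\<close> gives those of \<open>J t u\<close>, whose limit \<open>generator_J\<close>
  supplies.\<close>

lemma J_generator:
  assumes "0 \<le> t" and "((\<lambda>h. (1 / h) *\<^sub>R (W h u - u)) \<longlongrightarrow> v) (at_right 0)"
  shows "J t v = W t u - u"
proof (rule tendsto_unique[OF _ _ generator_J[OF assms(1)]])
  have "((\<lambda>h. J t ((1 / h) *\<^sub>R (W h u - u))) \<longlongrightarrow> J t v) (at_right 0)"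
    using bounded_linear.tendsto[OF bounded_linear_J assms(2)] assms(1) by blast
  then show "((\<lambda>h. (1 / h) *\<^sub>R (W h (J t u) - J t u)) \<longlongrightarrow> J t v) (at_right 0)"
  proof (rule Lim_transform_eventually)
    show "\<forall>\<^sub>F h in at_right 0. J t ((1 / h) *\<^sub>R (W h u - u)) = (1 / h) *\<^sub>R (W h (J t u) - J t u)"
      using J_commute linear_J assms(1)
      by (auto simp: linear_scale eventually_at_right_field intro!: exI[of _ 1])
  qed
qed simp

end

section \<open>Resolvents of substochastic semigroups\<close>

text \<open>The product rule at 0. Used with \<open>c = - lam\<close> and then with
  \<open>c = lam\<close>, it yields both directions of \<open>W_generator_iff\<close>.\<close>

lemma difference_quotient_rescale:
  fixes f :: "real \<Rightarrow> 'a::real_normed_vector"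
  assumes "((\<lambda>h. (1 / h) *\<^sub>R (f h - u)) \<longlongrightarrow> v) (at_right 0)"
  shows "((\<lambda>h. (1 / h) *\<^sub>R (exp (c * h) *\<^sub>R f h - u)) \<longlongrightarrow> v + c *\<^sub>R u) (at_right 0)"
proof (rule Lim_transform_eventually)
  have "((\<lambda>h. exp (c * h)) has_real_derivative c) (at 0)"
    by (auto intro!: derivative_eq_intros)
  then have "((\<lambda>h. (exp (c * h) - 1) / h) \<longlongrightarrow> c) (at_right 0)"
    by (auto simp: DERIV_def intro: tendsto_within_subset)
  moreover have "((\<lambda>h. exp (c * h)) \<longlongrightarrow> exp (c * 0)) (at_right 0)"
    by (intro tendsto_intros)
  ultimately have "((\<lambda>h. exp (c * h) *\<^sub>R ((1 / h) *\<^sub>R (f h - u)) + ((exp (c * h) - 1) / h) *\<^sub>R u)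
      \<longlongrightarrow> exp (c * 0) *\<^sub>R v + c *\<^sub>R u) (at_right 0)"
    using assms by (intro tendsto_intros)
  then show "((\<lambda>h. exp (c * h) *\<^sub>R ((1 / h) *\<^sub>R (f h - u)) + ((exp (c * h) - 1) / h) *\<^sub>R u)
      \<longlongrightarrow> v + c *\<^sub>R u) (at_right 0)"
    by simp
  show "\<forall>\<^sub>F h in at_right 0. exp (c * h) *\<^sub>R ((1 / h) *\<^sub>R (f h - u)) + ((exp (c * h) - 1) / h) *\<^sub>R u
      = (1 / h) *\<^sub>R (exp (c * h) *\<^sub>R f h - u)"
    by (simp add: algebra_simps diff_divide_distrib)
qed

lemma substochastic_semigroup_bound:
  fixes V :: "real \<Rightarrow> 'a::abstract_state_space \<Rightarrow>\<^sub>L 'a"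
  assumes "substochastic_semigroup V"
  shows "\<exists>M>0. \<forall>t\<ge>0. \<forall>u. norm (V t u) \<le> M * norm u"
proof -
  obtain M :: real where "M > 0"
    and M: "\<forall>(T :: 'a \<Rightarrow> 'a) u. linear T \<longrightarrow> (\<forall>v\<ge>0. norm (T v) \<le> norm v) \<longrightarrow> norm (T u) \<le> M * norm u"
    using cone_contractive_bound by blast
  have "linear (V t)" for t
    using blinfun.bounded_linear_right bounded_linear.linear by blast
  then show ?thesis
    using M \<open>M > 0\<close> assms by (auto simp: substochastic_semigroup_def substochastic_def)
qed

locale substochastic_generator =
  fixes V :: "real \<Rightarrow> 'a::abstract_state_space \<Rightarrow>\<^sub>L 'a" and D :: "'a set" and C :: "'a \<Rightarrow> 'a"
  assumes substochastic: "substochastic_semigroup V" and generator: "is_generator V D C"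
begin

lemma V_nonneg: "0 \<le> t \<Longrightarrow> 0 \<le> u \<Longrightarrow> 0 \<le> V t u"
  and norm_V_le: "0 \<le> t \<Longrightarrow> 0 \<le> u \<Longrightarrow> norm (V t u) \<le> norm u"
  using substochastic by (auto simp: substochastic_semigroup_def substochastic_def)

definition M :: real where
  "M = (SOME M. 0 < M \<and> (\<forall>t\<ge>0. \<forall>u. norm (V t u) \<le> M * norm u))"

lemma M_pos: "0 < M" and V_bound: "0 \<le> t \<Longrightarrow> norm (V t u) \<le> M * norm u"
  using someI_ex[OF substochastic_semigroup_bound[OF substochastic]]
  unfolding M_def[symmetric] by simp_all

text \<open>Uniqueness of limits merges the two clauses of \<open>is_generator\<close> into one
  equivalence, so that membership in the domain and the value are obtained together.\<close>

lemma generator_iff: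
  "u \<in> D \<and> C u = v \<longleftrightarrow> ((\<lambda>h. (1 / h) *\<^sub>R (V h u - u)) \<longlongrightarrow> v) (at_right 0)"
  using generator unfolding is_generator_def
  by (auto intro: tendsto_unique[OF trivial_limit_at_right_real])

lemma linear_operator: "linear_operator D C"
proof -
  have "u + v \<in> D \<and> C (u + v) = C u + C v" if "u \<in> D" "v \<in> D" for u v
    unfolding generator_iff
    using tendsto_add[OF iffD1[OF generator_iff[of u]] iffD1[OF generator_iff[of v]], of "C u" "C v"] that
    by (simp add: blinfun.add_right algebra_simps)
  moreover have "c *\<^sub>R u \<in> D \<and> C (c *\<^sub>R u) = c *\<^sub>R C u" if "u \<in> D" for c u
    unfolding generator_iff
    using tendsto_scaleR[OF tendsto_const iffD1[OF generator_iff[of u]], of "C u" c] that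
    by (simp add: blinfun.scaleR_right scaleR_diff_right mult.commute)
  moreover have "0 \<in> D"
    using generator_iff[of 0 0] by simp
  ultimately show ?thesis
    by (auto simp: linear_operator_def subspace_def)
qed

text \<open>The rescaled semigroup has generator \<open>C - lam\<close>, and for positive
  \<open>lam\<close> its norm becomes small at large times.\<close>

definition W :: "real \<Rightarrow> real \<Rightarrow> 'a \<Rightarrow>\<^sub>L 'a" where
  "W lam t = exp (- lam * t) *\<^sub>R V t"

lemma W_apply: "W lam t u = exp (- lam * t) *\<^sub>R V t u"
  by (simp add: W_def blinfun.scaleR_left)

lemma W_semigroup: "0 \<le> lam \<Longrightarrow> bounded_C0_semigroup (W lam) M"
proof (unfold_locales)
  have "((\<lambda>t. exp (- lam * t) *\<^sub>R V t u) \<longlongrightarrow> exp (- lam * 0) *\<^sub>R u) (at_right 0)" for u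
    using substochastic
    by (intro tendsto_intros) (simp add: substochastic_semigroup_def C0_semigroup_def)
  then show "C0_semigroup (W lam)"
    using substochastic unfolding substochastic_semigroup_def C0_semigroup_def
    by (auto intro!: blinfun_eqI simp: W_apply blinfun.scaleR_right ring_distribs exp_add exp_diff)
       (simp_all add: W_def ring_distribs exp_add exp_diff exp_minus divide_inverse)
  show "norm (W lam t u) \<le> M * norm u" if "0 \<le> lam" "0 \<le> t" for t u
  proof -
    have "norm (W lam t u) \<le> 1 * norm (V t u)"
      unfolding W_apply norm_scaleR using that by (intro mult_right_mono) auto
    then show ?thesis
      using V_bound[OF that(2), of u] by simp
  qed
qed (simp_all add: M_pos)

lemma W_generator_iff:
  "u \<in> D \<and> C u = v \<longleftrightarrow> ((\<lambda>h. (1 / h) *\<^sub>R (W lam h u - u)) \<longlongrightarrow> v - lam *\<^sub>R u) (at_right 0)"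
  unfolding generator_iff
proof
  assume "((\<lambda>h. (1 / h) *\<^sub>R (V h u - u)) \<longlongrightarrow> v) (at_right 0)"
  then show "((\<lambda>h. (1 / h) *\<^sub>R (W lam h u - u)) \<longlongrightarrow> v - lam *\<^sub>R u) (at_right 0)"
    using difference_quotient_rescale[of "\<lambda>h. V h u" u v "- lam"] by (simp add: W_apply)
next
  assume "((\<lambda>h. (1 / h) *\<^sub>R (W lam h u - u)) \<longlongrightarrow> v - lam *\<^sub>R u) (at_right 0)"
  then show "((\<lambda>h. (1 / h) *\<^sub>R (V h u - u)) \<longlongrightarrow> v) (at_right 0)"
    using difference_quotient_rescale[of "\<lambda>h. W lam h u" u "v - lam *\<^sub>R u" lam]
    by (simp add: W_apply flip: exp_add)
qed

section \<open>Bijectivity of \<open>lam - C\<close>\<close>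

lemma W_decay:
  assumes "0 < lam"
  shows "\<exists>t\<ge>0. \<forall>u. norm (W lam t u) \<le> norm u / 2"
proof -
  \<comment> \<open>This makes \<open>exp (- lam * t) = 1 / (2 * M + 1)\<close>, hence
    \<open>exp (- lam * t) * M \<le> 1 / 2\<close>; the summand 1 keeps the logarithm
    nonnegative.\<close>
  define t where "t = ln (2 * M + 1) / lam"
  have exp_eq: "exp (- lam * t) = 1 / (2 * M + 1)"
  proof -
    have "lam * t = ln (2 * M + 1)"
      using assms by (simp add: t_def)
    then show ?thesis
      using M_pos by (simp add: exp_minus inverse_eq_divide)
  qed
  have *: "exp (- lam * t) * M \<le> 1 / 2"
    unfolding exp_eq using M_pos by (simp add: field_simps)
  have "0 \<le> t"
    using assms M_pos by (simp add: t_def)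
  moreover have "norm (W lam t u) \<le> norm u / 2" for u
  proof -
    have "norm (W lam t u) \<le> exp (- lam * t) * (M * norm u)"
      unfolding W_apply norm_scaleR using V_bound[OF \<open>0 \<le> t\<close>, of u]
      by (intro mult_mono) auto
    also have "\<dots> \<le> norm u / 2"
      using mult_right_mono[OF *, of "norm u"] by (simp add: mult.assoc)
    finally show ?thesis .
  qed
  ultimately show ?thesis
    by blast
qed

text \<open>Such a \<open>u\<close> is annihilated by the generator of \<open>W lam\<close> and so
  fixed by \<open>W lam t\<close>, which halves norms for the \<open>t\<close> of
  \<open>W_decay\<close>.\<close>

lemma resolvent_injective:
  assumes "0 < lam" "u \<in> D" "lam *\<^sub>R u = C u"
  shows "u = 0"
proof -
  interpret W: bounded_C0_semigroup "W lam" M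
    using W_semigroup assms(1) by simp
  obtain t where t: "0 \<le> t" "\<And>u. norm (W lam t u) \<le> norm u / 2"
    using W_decay[OF assms(1)] by blast
  have "((\<lambda>h. (1 / h) *\<^sub>R (W lam h u - u)) \<longlongrightarrow> 0) (at_right 0)"
    using W_generator_iff[of u "C u" lam] assms by simp
  then have "W lam t u = u"
    using W.J_generator[OF t(1), of u 0] linear_0[OF W.linear_J[of t]] by simp
  then show ?thesis
    using t(2)[of u] by simp
qed

text \<open>Choosing $t$ with $\|e^{-\lambda t}V(t)\| \le 1/2$, the solution is $\int_0^t e^{-\lambda s}V(s)y\,ds$
  where $y$ is the fixed point of the contraction $y \mapsto w + e^{-\lambda t}V(t)y$; positivity of
  the resolvent is thus obtained without improper integrals.\<close>

lemma resolvent_surjective: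
  assumes "0 < lam"
  shows "\<exists>u\<in>D. lam *\<^sub>R u - C u = w \<and> (0 \<le> w \<longrightarrow> 0 \<le> u)"
proof -
  interpret W: bounded_C0_semigroup "W lam" M
    using W_semigroup assms(1) by simp
  obtain t where t: "0 \<le> t" "\<And>u. norm (W lam t u) \<le> norm u / 2"
    using W_decay[OF assms(1)] by blast
  define f where "f y = w + W lam t y" for y
  have lip: "dist (f x) (f y) \<le> 1 / 2 * dist x y" for x y
    using t(2)[of "x - y"] by (simp add: f_def dist_norm blinfun.diff_right)
  have "\<exists>!y. f y = y"
    using lip by (intro banach_fix_type[of "1 / 2"]) auto
  then obtain y where y: "f y = y"
    by blast
  \<comment> \<open>The Banach iterates started at 0 stay in the cone.\<close>
  have y_nonneg: "0 \<le> y" if "0 \<le> w"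
  proof (rule nonneg_LIMSEQ)
    show "0 \<le> (f ^^ n) 0" for n
      using that t(1) by (induction n) (auto simp: f_def W_apply intro!: add_nonneg_nonneg scaleR_nonneg_nonneg V_nonneg)
    have "dist ((f ^^ n) 0) y \<le> (1 / 2) ^ n * dist 0 y" for n
    proof (induction n)
      case (Suc n)
      then show ?case
        using lip[of "(f ^^ n) 0" y] y by simp
    qed simp
    then have "\<forall>\<^sub>F n in sequentially. norm ((f ^^ n) 0 - y) \<le> (1 / 2) ^ n * dist 0 y"
      by (simp add: dist_norm)
    moreover have "(\<lambda>n. (1 / 2) ^ n * dist 0 y) \<longlonglongrightarrow> 0"
      by (intro tendsto_mult_left_zero LIMSEQ_power_zero) auto
    ultimately have "(\<lambda>n. (f ^^ n) 0 - y) \<longlonglongrightarrow> 0"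
      by (rule Lim_null_comparison)
    then show "(\<lambda>n. (f ^^ n) 0) \<longlonglongrightarrow> y"
      by (simp add: LIM_zero_iff)
  qed
  define u where "u = W.J t y"
  have "W lam t y - y = - w"
    using y by (simp add: f_def algebra_simps)
  \<comment> \<open>The limit \<open>- w\<close> is written as
    \<open>(lam *\<^sub>R u - w) - lam *\<^sub>R u\<close> so that \<open>W_generator_iff\<close>
    reads off \<open>C u\<close>.\<close>
  then have "((\<lambda>h. (1 / h) *\<^sub>R (W lam h u - u)) \<longlongrightarrow> (lam *\<^sub>R u - w) - lam *\<^sub>R u) (at_right 0)"
    using W.generator_J[OF t(1), of y] by (simp add: u_def)
  then have "u \<in> D \<and> C u = lam *\<^sub>R u - w"
    using W_generator_iff by blast
  moreover have "0 \<le> u" if "0 \<le> w"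
    unfolding u_def
    by (rule has_integral_nonneg_cone[OF W.J_has_integral])
       (auto simp: W_apply y_nonneg[OF that] intro!: scaleR_nonneg_nonneg V_nonneg)
  ultimately show ?thesis
    by (intro bexI[of _ u]) auto
qed

lemma inj_on_resolvent: "0 < lam \<Longrightarrow> inj_on (\<lambda>u. lam *\<^sub>R u - C u) D"
proof (rule inj_onI)
  fix u v assume *: "0 < lam" "u \<in> D" "v \<in> D" "lam *\<^sub>R u - C u = lam *\<^sub>R v - C v"
  have "u - v \<in> D" "C (u - v) = C u - C v"
  proof -
    \<comment> \<open>\<open>linear_operator\<close> speaks of sums and multiples only, so the
      difference is written with the factor -1.\<close>
    have "u + (-1) *\<^sub>R v \<in> D" "C (u + (-1) *\<^sub>R v) = C u + (-1) *\<^sub>R C v"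
      using linear_operator *(2,3) unfolding linear_operator_def
      by (metis subspace_add subspace_scale)+
    then show "u - v \<in> D" "C (u - v) = C u - C v"
      by simp_all
  qed
  moreover have "lam *\<^sub>R (u - v) = C u - C v"
    using *(4) by (simp add: scaleR_diff_right diff_eq_eq add_diff_eq)
  ultimately have "u - v = 0"
    using *(1) by (intro resolvent_injective) auto
  then show "u = v"
    by simp
qed

lemma resolvent_in_domain: "0 < lam \<Longrightarrow> resolvent D C lam w \<in> D"
  and resolvent_right_inverse: "0 < lam \<Longrightarrow> lam *\<^sub>R resolvent D C lam w - C (resolvent D C lam w) = w"
proof -
  assume "0 < lam"
  then have "w \<in> (\<lambda>u. lam *\<^sub>R u - C u) ` D"
    using resolvent_surjective[of lam w] by force
  then show "resolvent D C lam w \<in> D" "lam *\<^sub>R resolvent D C lam w - C (resolvent D C lam w) = w"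
    unfolding resolvent_def by (rule inv_into_into, rule f_inv_into_f)
qed

lemma resolvent_left_inverse: "0 < lam \<Longrightarrow> u \<in> D \<Longrightarrow> resolvent D C lam (lam *\<^sub>R u - C u) = u"
  unfolding resolvent_def by (rule inv_into_f_f[OF inj_on_resolvent])

lemma resolvent_eqI: "0 < lam \<Longrightarrow> u \<in> D \<Longrightarrow> lam *\<^sub>R u - C u = w \<Longrightarrow> resolvent D C lam w = u"
  using resolvent_left_inverse by blast

lemma resolvent_nonneg: "0 < lam \<Longrightarrow> 0 \<le> w \<Longrightarrow> 0 \<le> resolvent D C lam w"
  using resolvent_surjective[of lam w] resolvent_eqI by fastforce

lemma linear_resolvent:
  assumes "0 < lam"
  shows "linear (resolvent D C lam)"
proof (rule linearI)
  note [simp] = resolvent_in_domain[OF assms]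
  note inverse = resolvent_right_inverse[OF assms]
  fix v w
  have "lam *\<^sub>R (resolvent D C lam v + resolvent D C lam w)
      - C (resolvent D C lam v + resolvent D C lam w) = v + w"
    using linear_operator inverse[of v] inverse[of w]
    by (simp add: linear_operator_def scaleR_add_right) (simp add: algebra_simps)
  then show "resolvent D C lam (v + w) = resolvent D C lam v + resolvent D C lam w"
    using linear_operator assms by (intro resolvent_eqI) (auto simp: linear_operator_def subspace_add)
next
  note [simp] = resolvent_in_domain[OF assms]
  fix c w
  have "lam *\<^sub>R (c *\<^sub>R resolvent D C lam w) - C (c *\<^sub>R resolvent D C lam w)
      = c *\<^sub>R (lam *\<^sub>R resolvent D C lam w - C (resolvent D C lam w))"
    using linear_operator by (simp add: linear_operator_def scaleR_diff_right mult.commute)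
  then show "resolvent D C lam (c *\<^sub>R w) = c *\<^sub>R resolvent D C lam w"
    using linear_operator assms resolvent_right_inverse[OF assms]
    by (intro resolvent_eqI) (auto simp: linear_operator_def subspace_scale)
qed

end

section \<open>The powers of $BR(\lambda,A)$\<close>

lemma linear_funpow:
  fixes T :: "'a::real_vector \<Rightarrow> 'a"
  assumes "linear T"
  shows "linear (T ^^ n)"
proof (induction n)
  case (Suc n)
  then show ?case
    using linear_compose[OF Suc assms] by (simp add: o_def)
qed (simp add: linear_iff)

locale kato =
  fixes A B G :: "'a::abstract_state_space \<Rightarrow> 'a"
    and DA DB DG :: "'a set"
    and V :: "real \<Rightarrow> 'a \<Rightarrow>\<^sub>L 'a"
  assumes conditions: "kato_conditions DA A DB B"
    and semigroup: "kato_semigroup DA A B V DG G"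
begin

text \<open>The conditions only assert that some semigroup has generator \<open>A\<close>; fixing a
  choice allows the sublocale to be declared.\<close>

definition S :: "real \<Rightarrow> 'a \<Rightarrow>\<^sub>L 'a" where
  "S = (SOME S. substochastic_semigroup S \<and> is_generator S DA A)"

sublocale A: substochastic_generator S DA A
proof
  have "\<exists>S. substochastic_semigroup S \<and> is_generator S DA A"
    using conditions unfolding kato_conditions_def by (elim conjE)
  from someI_ex[OF this, folded S_def] show "substochastic_semigroup S" "is_generator S DA A"
    by auto
qed

sublocale G: substochastic_generator V DG G
  using semigroup by unfold_locales (auto simp: kato_semigroup_def)

abbreviation R :: "real \<Rightarrow> 'a \<Rightarrow> 'a" where
  "R \<equiv> resolvent DA A"

abbreviation RG :: "real \<Rightarrow> 'a \<Rightarrow> 'a" where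
  "RG \<equiv> resolvent DG G"

definition K :: "real \<Rightarrow> 'a \<Rightarrow> 'a" where
  "K lam u = B (R lam u)"

lemma DA_subset: "DA \<subseteq> DG" and G_eq: "u \<in> DA \<Longrightarrow> G u = A u + B u"
  using semigroup by (auto simp: kato_semigroup_def operator_extends_def)

lemma B_nonneg: "u \<in> DA \<Longrightarrow> 0 \<le> u \<Longrightarrow> 0 \<le> B u"
  using conditions by (simp add: kato_conditions_def)

lemma a_functional_nonneg: "u \<in> DA \<Longrightarrow> 0 \<le> u \<Longrightarrow> 0 \<le> a_functional A B u"
  using conditions by (simp add: kato_conditions_def a_functional_def)

lemma B_add: "u \<in> DA \<Longrightarrow> v \<in> DA \<Longrightarrow> B (u + v) = B u + B v"
  and B_scale: "u \<in> DA \<Longrightarrow> B (c *\<^sub>R u) = c *\<^sub>R B u"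
  using conditions by (auto simp: kato_conditions_def linear_operator_def subset_iff)

lemma subspace_DA: "subspace DA"
  using A.linear_operator by (simp add: linear_operator_def)

context
  fixes lam :: real
  assumes lam: "0 < lam"
begin

lemma linear_K: "linear (K lam)"
  using A.linear_resolvent[OF lam] A.resolvent_in_domain[OF lam]
  by (intro linearI) (auto simp: K_def linear_add linear_scale B_add B_scale)

lemma K_nonneg: "0 \<le> u \<Longrightarrow> 0 \<le> K lam u"
  unfolding K_def by (intro B_nonneg A.resolvent_in_domain A.resolvent_nonneg lam)

text \<open>Apply Psi to $BR = (A + B)R - AR$ and insert $AR = lam R - I$.\<close>

lemma Psi_K: "blinfun_apply Psi (K lam u) =
    blinfun_apply Psi u - lam * blinfun_apply Psi (R lam u) - a_functional A B (R lam u)"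
proof -
  have "A (R lam u) = lam *\<^sub>R R lam u - u"
    using A.resolvent_right_inverse[OF lam, of u] by (simp add: algebra_simps)
  then show ?thesis
    by (simp add: a_functional_def K_def blinfun.add_right blinfun.diff_right blinfun.scaleR_right)
qed

lemma norm_K_le:
  assumes "0 \<le> u"
  shows "norm (K lam u) \<le> norm u"
proof -
  have "0 \<le> R lam u"
    using assms by (intro A.resolvent_nonneg lam)
  moreover from this have "0 \<le> a_functional A B (R lam u)"
    by (intro a_functional_nonneg A.resolvent_in_domain lam)
  moreover have "0 \<le> lam * norm (R lam u)"
    using lam by simp
  moreover have "norm (K lam u) = norm u - lam * norm (R lam u) - a_functional A B (R lam u)"
    using Psi_K[of u] K_nonneg[OF assms] assms \<open>0 \<le> R lam u\<close> by (simp add: Psi_nonneg)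
  ultimately show ?thesis
    by linarith
qed

lemma linear_K_power: "linear (K lam ^^ n)"
  by (rule linear_funpow[OF linear_K])

lemma K_power_nonneg: "0 \<le> u \<Longrightarrow> 0 \<le> (K lam ^^ n) u"
  by (induction n) (auto intro: K_nonneg)

lemma norm_K_power_le: "0 \<le> u \<Longrightarrow> norm ((K lam ^^ n) u) \<le> norm u"
  by (induction n) (auto intro: order_trans[OF norm_K_le[OF K_power_nonneg]])

lemma K_power_bound: "\<exists>M>0. \<forall>n u. norm ((K lam ^^ n) u) \<le> M * norm u"
proof -
  obtain M :: real where "M > 0"
    and M: "\<forall>(T :: 'a \<Rightarrow> 'a) u. linear T \<longrightarrow> (\<forall>v\<ge>0. norm (T v) \<le> norm v) \<longrightarrow> norm (T u) \<le> M * norm u"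
    using cone_contractive_bound by blast
  then show ?thesis
    using linear_K_power norm_K_power_le by blast
qed

lemma bounded_linear_K: "bounded_linear (K lam)"
proof -
  obtain M where M: "\<forall>n u. norm ((K lam ^^ n) u) \<le> M * norm u"
    using K_power_bound by blast
  show ?thesis
    using linear_K spec[OF M, of 1]
    by (intro bounded_linear_intro[of _ M]) (auto simp: linear_add linear_scale mult.commute)
qed

section \<open>The limit functional of the powers\<close>

definition beta :: "'a \<Rightarrow> real" where
  "beta u = lim (\<lambda>n. blinfun_apply Psi ((K lam ^^ n) u))"

text \<open>On the cone the sequence consists of the decreasing norms of the powers; a general
  \<open>u\<close> is a difference of cone elements.\<close>

lemma beta_LIMSEQ: "(\<lambda>n. blinfun_apply Psi ((K lam ^^ n) u)) \<longlonglongrightarrow> beta u"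
proof -
  have *: "convergent (\<lambda>n. blinfun_apply Psi ((K lam ^^ n) u))" if "0 \<le> u" for u
  proof -
    have "decseq (\<lambda>n. norm ((K lam ^^ n) u))"
      using that by (intro decseq_SucI) (auto intro: norm_K_le K_power_nonneg)
    then have "convergent (\<lambda>n. norm ((K lam ^^ n) u))"
      using decseq_convergent[of _ 0] norm_ge_zero by (metis convergentI)
    then show ?thesis
      using that by (simp add: Psi_nonneg K_power_nonneg)
  qed
  obtain v w where "0 \<le> v" "0 \<le> w" "u = v - w"
    using generating_cone by blast
  then have "convergent (\<lambda>n. blinfun_apply Psi ((K lam ^^ n) u))"
    using convergent_diff[OF *[of v] *[of w]]
    by (simp add: linear_diff[OF linear_K_power] blinfun.diff_right)
  then show ?thesis
    unfolding beta_def by (simp add: convergent_LIMSEQ_iff)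
qed

lemma linear_beta: "linear beta"
proof (rule linearI)
  fix u v c
  show "beta (u + v) = beta u + beta v"
    using tendsto_add[OF beta_LIMSEQ[of u] beta_LIMSEQ[of v]] beta_LIMSEQ[of "u + v"]
    by (simp add: linear_add[OF linear_K_power] blinfun.add_right LIMSEQ_unique)
  show "beta (c *\<^sub>R u) = c *\<^sub>R beta u"
    using tendsto_mult_left[OF beta_LIMSEQ[of u], of c] beta_LIMSEQ[of "c *\<^sub>R u"]
    by (simp add: linear_scale[OF linear_K_power] blinfun.scaleR_right LIMSEQ_unique)
qed

lemma beta_nonneg: "0 \<le> u \<Longrightarrow> 0 \<le> beta u"
  by (rule LIMSEQ_le_const[OF beta_LIMSEQ]) (auto simp: Psi_nonneg K_power_nonneg)

lemma beta_le: "0 \<le> u \<Longrightarrow> beta u \<le> norm u"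
  by (rule LIMSEQ_le_const2[OF beta_LIMSEQ]) (auto simp: Psi_nonneg K_power_nonneg norm_K_power_le)

lemma bounded_linear_beta: "bounded_linear beta"
proof -
  obtain M :: real
    where "\<forall>(T :: 'a \<Rightarrow> real) u. linear T \<longrightarrow> (\<forall>v\<ge>0. norm (T v) \<le> norm v) \<longrightarrow> norm (T u) \<le> M * norm u"
    using cone_contractive_bound by blast
  then have "norm (beta u) \<le> norm u * M" for u
    using linear_beta beta_nonneg beta_le by (simp add: mult.commute)
  then show ?thesis
    using linear_beta by (intro bounded_linear_intro[of _ M]) (auto simp: linear_add linear_scale)
qed

lemma beta_K: "beta (K lam u) = beta u"
  using LIMSEQ_unique[OF LIMSEQ_Suc[OF beta_LIMSEQ[of u]]] beta_LIMSEQ[of "K lam u"]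
  by (simp add: funpow_Suc_right del: funpow.simps)

lemma kato_term_eq: "kato_term DA A B lam k u = R lam ((K lam ^^ k) u)"
  by (simp add: kato_term_def K_def[abs_def])

lemma RG_sums: "(\<lambda>k. R lam ((K lam ^^ k) u)) sums RG lam u"
  unfolding kato_term_eq[symmetric] using semigroup lam by (simp add: kato_semigroup_def)

text \<open>By \<open>Psi_K\<close> each term is a telescoping difference minus \<open>lam\<close>
  times Psi of a term of the resolvent series.\<close>

lemma a_functional_sums:
  "(\<lambda>k. a_functional A B (R lam ((K lam ^^ k) u))) sums
     (blinfun_apply Psi u - beta u - lam * blinfun_apply Psi (RG lam u))"
proof -
  have "(\<lambda>n. blinfun_apply Psi ((K lam ^^ n) u) - blinfun_apply Psi ((K lam ^^ Suc n) u))
      sums (blinfun_apply Psi ((K lam ^^ 0) u) - beta u)"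
    by (rule telescope_sums'[OF beta_LIMSEQ])
  moreover have "(\<lambda>k. lam * blinfun_apply Psi (R lam ((K lam ^^ k) u)))
      sums (lam * blinfun_apply Psi (RG lam u))"
    by (intro sums_mult bounded_linear.sums[OF blinfun.bounded_linear_right] RG_sums)
  ultimately show ?thesis
    using sums_diff by (fastforce simp: Psi_K)
qed

text \<open>Starting the resolvent series at \<open>(K lam ^^ n) u\<close> gives its tail from index
  \<open>n\<close>. Hence these vectors tend to 0 even when the powers themselves do not.\<close>

lemma RG_K_power: "RG lam ((K lam ^^ n) u) = RG lam u - (\<Sum>k<n. R lam ((K lam ^^ k) u))"
proof -
  have "(\<lambda>k. R lam ((K lam ^^ (k + n)) u)) sums (RG lam u - (\<Sum>k<n. R lam ((K lam ^^ k) u)))"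
    by (rule sums_split_initial_segment[OF RG_sums])
  moreover have "(\<lambda>k. R lam ((K lam ^^ (k + n)) u)) sums RG lam ((K lam ^^ n) u)"
    using RG_sums[of "(K lam ^^ n) u"] by (simp add: funpow_add)
  ultimately show ?thesis
    by (rule sums_unique2[symmetric])
qed

lemma RG_K_power_LIMSEQ: "(\<lambda>n. RG lam ((K lam ^^ n) u)) \<longlonglongrightarrow> 0"
  using tendsto_diff[OF tendsto_const RG_sums[of u, unfolded sums_def], of "RG lam u"]
  by (simp add: RG_K_power)

lemma K_fixed_eq_0:
  assumes "K lam v = v"
  shows "v = 0"
proof -
  have "(K lam ^^ k) v = v" for k
    by (induction k) (auto simp: assms)
  then have "(\<lambda>k::nat. R lam v) \<longlonglongrightarrow> 0"
    using summable_LIMSEQ_zero[OF sums_summable[OF RG_sums[of v]]] by simp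
  then have "R lam v = 0"
    by (simp add: LIMSEQ_const_iff)
  moreover have "B 0 = 0"
    using B_scale[of 0 0] subspace_DA by (simp add: subspace_0)
  ultimately show ?thesis
    using assms by (simp add: K_def)
qed

end

section \<open>Independence of $\lambda$\<close>

text \<open>This carries \<open>beta lam\<close> over to the domain of \<open>G\<close>, where
  different values of \<open>lam\<close> can be compared. By \<open>abar_eq\<close> it is the gap
  between \<open>abar\<close> and $-Psi(Gv)$.\<close>

definition b :: "real \<Rightarrow> 'a \<Rightarrow> real" where
  "b lam v = beta lam (lam *\<^sub>R v - G v)"

lemma b_RG: "0 < lam \<Longrightarrow> b lam (RG lam u) = beta lam u"
  by (simp add: b_def G.resolvent_right_inverse)

lemma b_diff:
  assumes "0 < lam" "u \<in> DG" "v \<in> DG"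
  shows "b lam (u - v) = b lam u - b lam v"
proof -
  have "G (u + (-1) *\<^sub>R v) = G u + (-1) *\<^sub>R G v"
    using G.linear_operator assms(2,3) unfolding linear_operator_def
    by (metis subspace_scale)
  then have "lam *\<^sub>R (u - v) - G (u - v) = (lam *\<^sub>R u - G u) - (lam *\<^sub>R v - G v)"
    by (simp add: algebra_simps)
  then show ?thesis
    unfolding b_def using linear_beta[OF assms(1)] by (simp only: linear_diff)
qed

lemma b_DA:
  assumes "0 < lam" "v \<in> DA"
  shows "b lam v = 0"
proof -
  \<comment> \<open>With this \<open>y\<close>, $(lam - G)v = (I - K)y$, and \<open>beta lam\<close>
    is invariant under \<open>K lam\<close>.\<close>
  define y where "y = lam *\<^sub>R v - A v"
  have "lam *\<^sub>R v - G v = y - K lam y"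
    using assms by (simp add: y_def K_def G_eq A.resolvent_left_inverse)
  then show ?thesis
    unfolding b_def using beta_K[OF assms(1)] linear_beta[OF assms(1)] by (simp add: linear_diff)
qed

text \<open>Since \<open>b lam\<close> vanishes on $D(A)$, \<open>w\<close> may be replaced by $(BR(\mu,A))^n w$, and
  $R(\mu,G)(BR(\mu,A))^n w \to 0$.\<close>

lemma b_RG_le:
  assumes lam: "0 < lam" and mu: "0 < mu" and w: "0 \<le> w"
  shows "b lam (RG mu w) \<le> beta mu w"
proof (rule LIMSEQ_le_const)
  let ?w = "\<lambda>n. (K mu ^^ n) w"
  have RG_DG: "RG mu x \<in> DG" for x
    using G.resolvent_in_domain[OF mu] .
  have b_eq: "b lam (RG mu (?w n)) = b lam (RG mu w)" for n
  proof -
    have "(\<Sum>k<n. R mu (?w k)) \<in> DA"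
      using subspace_DA A.resolvent_in_domain[OF mu] by (intro subspace_sum) auto
    then show ?thesis
      using DA_subset RG_DG lam by (simp add: RG_K_power[OF mu] b_diff b_DA subset_iff)
  qed
  have "b lam (RG mu (?w n)) \<le>
      blinfun_apply Psi (?w n) + \<bar>lam - mu\<bar> * norm (RG mu (?w n))" for n
  proof -
    have nonneg: "0 \<le> ?w n" "0 \<le> RG mu (?w n)"
      using K_power_nonneg[OF mu w] G.resolvent_nonneg[OF mu] by auto
    \<comment> \<open>Changing the parameter from \<open>mu\<close> to \<open>lam\<close> costs a
      multiple of \<open>RG mu (?w n)\<close>, which vanishes as \<open>n\<close> grows.\<close>
    have "lam *\<^sub>R RG mu (?w n) - G (RG mu (?w n)) = ?w n + (lam - mu) *\<^sub>R RG mu (?w n)"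
      using G.resolvent_right_inverse[OF mu, of "?w n"] by (simp add: algebra_simps)
    then have "b lam (RG mu (?w n)) = beta lam (?w n) + (lam - mu) * beta lam (RG mu (?w n))"
      using linear_beta[OF lam] by (simp add: b_def linear_add linear_scale)
    moreover have "(lam - mu) * beta lam (RG mu (?w n)) \<le> \<bar>lam - mu\<bar> * norm (RG mu (?w n))"
      using beta_nonneg[OF lam nonneg(2)] beta_le[OF lam nonneg(2)]
      by (intro mult_mono) auto
    ultimately show ?thesis
      using beta_le[OF lam nonneg(1)] nonneg(1) by (simp add: Psi_nonneg)
  qed
  then show "\<exists>N. \<forall>n\<ge>N. b lam (RG mu w) \<le>
      blinfun_apply Psi (?w n) + \<bar>lam - mu\<bar> * norm (RG mu (?w n))"
    by (simp add: b_eq)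
  show "(\<lambda>n. blinfun_apply Psi (?w n) + \<bar>lam - mu\<bar> * norm (RG mu (?w n))) \<longlonglongrightarrow> beta mu w"
    using tendsto_add[OF beta_LIMSEQ[OF mu, of w]
        tendsto_mult_left[OF tendsto_norm[OF RG_K_power_LIMSEQ[OF mu, of w]], of "\<bar>lam - mu\<bar>"]]
    by simp
qed

text \<open>For $\mu < \lambda$ the resolvent equation gives
  $R(\mu,G)X_+ \subseteq R(\lambda,G)X_+$, so that the two inequalities for the
  pairs $(\lambda,\mu)$ and $(\mu,\lambda)$ both hold on $R(\mu,G)X_+$.\<close>

lemma b_independent:
  assumes "0 < lam" "0 < mu" "v \<in> DG"
  shows "b lam v = b mu v"
proof -
  have *: "b lam v = b mu v" if mu: "0 < mu" and less: "mu < lam" and v: "v \<in> DG" for lam mu v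
  proof -
    have lam: "0 < lam"
      using mu less by simp
    have cone: "b lam (RG mu u) = b mu (RG mu u)" if "0 \<le> u" for u
    proof (rule antisym)
      show "b lam (RG mu u) \<le> b mu (RG mu u)"
        using b_RG_le[OF lam mu that] by (simp add: b_RG[OF mu])
      define w where "w = u + (lam - mu) *\<^sub>R RG mu u"
      have "0 \<le> w"
        unfolding w_def using that less G.resolvent_nonneg[OF mu that]
        by (intro add_nonneg_nonneg scaleR_nonneg_nonneg) auto
      have "RG lam w = RG mu u"
      proof (rule G.resolvent_eqI[OF lam G.resolvent_in_domain[OF mu]])
        show "lam *\<^sub>R RG mu u - G (RG mu u) = w"
          using G.resolvent_right_inverse[OF mu, of u] by (simp add: w_def algebra_simps)
      qed
      then show "b mu (RG mu u) \<le> b lam (RG mu u)"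
        using b_RG_le[OF mu lam \<open>0 \<le> w\<close>] b_RG[OF lam, of w] by simp
    qed
    obtain x y where xy: "0 \<le> x" "0 \<le> y" "mu *\<^sub>R v - G v = x - y"
      using generating_cone by blast
    then have "v = RG mu x - RG mu y"
      using G.resolvent_left_inverse[OF mu v] G.linear_resolvent[OF mu] by (simp add: linear_diff)
    then show ?thesis
      using cone xy(1,2) G.resolvent_in_domain[OF mu] lam mu by (simp add: b_diff)
  qed
  show ?thesis
    using *[of lam mu v] *[of mu lam v] assms by (cases lam mu rule: linorder_cases) auto
qed

text \<open>The description in \<open>abar\<close> ranges over all parameters and all
  representations of \<open>v\<close>; \<open>b_independent\<close> is what makes their sums
  agree.\<close>

lemma abar_eq:
  assumes lam: "0 < lam" and v: "v \<in> DG"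
  shows "abar DA A B DG G v = - blinfun_apply Psi (G v) - b lam v"
  unfolding abar_def
proof (rule the_equality)
  have *: "(\<lambda>k. a_functional A B (kato_term DA A B mu k u)) sums (- blinfun_apply Psi (G v) - b lam v)"
    if mu: "0 < mu" and u: "RG mu u = v" for mu u
  proof -
    have "u = mu *\<^sub>R v - G v"
      using G.resolvent_right_inverse[OF mu, of u] u by simp
    then show ?thesis
      using a_functional_sums[OF mu, of u] b_independent[OF lam mu v] u mu
      by (simp add: kato_term_eq b_def blinfun.diff_right blinfun.scaleR_right)
  qed
  then show "\<forall>mu>0. \<forall>u. RG mu u = v \<longrightarrow>
      (\<lambda>k. a_functional A B (kato_term DA A B mu k u)) sums (- blinfun_apply Psi (G v) - b lam v)"
    by blast
  fix r
  assume r: "\<forall>mu>0. \<forall>u. RG mu u = v \<longrightarrow>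
      (\<lambda>k. a_functional A B (kato_term DA A B mu k u)) sums r"
  \<comment> \<open>At least one representation of \<open>v\<close> exists, so the condition on
    \<open>r\<close> is not vacuous and determines it.\<close>
  have "RG lam (lam *\<^sub>R v - G v) = v"
    using G.resolvent_left_inverse[OF lam v] .
  then show "r = - blinfun_apply Psi (G v) - b lam v"
    using r *[OF lam] lam sums_unique2 by blast
qed

section \<open>Honesty\<close>

lemma honest_iff_beta_eq_0:
  assumes lam: "0 < lam"
  shows "honest DA A B V DG G \<longleftrightarrow> (\<forall>u. beta lam u = 0)"
proof -
  \<comment> \<open>The semigroup itself is the case \<open>lam = 0\<close> of
    \<open>G.W\<close>.\<close>
  interpret V: bounded_C0_semigroup V G.M
    using G.W_semigroup[of 0] by (simp add: G.W_def[abs_def])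
  have J: "V.J t u \<in> DG" "G (V.J t u) = V t u - u" if "0 \<le> t" for t u
    using V.generator_J[OF that, of u] G.generator_iff by auto
  \<comment> \<open>As \<open>G (V.J t u) = V t u - u\<close>, the Psi term of
    \<open>abar_eq\<close> already accounts for the change of norm, and only \<open>b\<close>
    remains.\<close>
  have equiv: "norm (V t u) - norm u = - abar DA A B DG G (integral {0..t} (\<lambda>s. V s u)) \<longleftrightarrow>
      b lam (V.J t u) = 0" if "0 \<le> t" "0 \<le> u" for t u
    using abar_eq[OF lam J(1)[OF that(1)], of u] J(2)[OF that(1), of u] G.V_nonneg[OF that] that(2)
    by (auto simp: V.J_def blinfun.diff_right Psi_nonneg)
  show ?thesis
  proof
    assume "honest DA A B V DG G"
    then have b_J: "b lam (V.J t u) = 0" if "0 \<le> t" "0 \<le> u" for t u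
      using equiv that by (simp add: honest_def)
    have cone: "beta lam u = 0" if u: "0 \<le> u" for u
    proof -
      have J_nonneg: "0 \<le> V.J t u" for t
        by (rule has_integral_nonneg_cone[OF V.J_has_integral]) (auto simp: G.V_nonneg u)
      have beta_V: "beta lam (V t u) = beta lam u + lam * beta lam (V.J t u)" if "0 \<le> t" for t
        using b_J[OF that u] J(2)[OF that, of u] linear_beta[OF lam]
        by (simp add: b_def linear_diff linear_scale)
      have mono: "beta lam u \<le> beta lam (V t u)" if "0 \<le> t" for t
        using beta_V[OF that] beta_nonneg[OF lam J_nonneg] lam by simp
      \<comment> \<open>By \<open>mono\<close> the integrand \<open>beta lam (V s u)\<close> is at
        least \<open>beta lam u\<close>, which forces linear growth in \<open>t\<close> below the
        fixed bound \<open>norm u\<close>.\<close>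
      have growth: "beta lam u * (1 + lam * t) \<le> norm u" if t: "0 \<le> t" for t
      proof -
        have int_V: "((\<lambda>s. beta lam (V s u)) has_integral beta lam (V.J t u)) {0..t}"
          using has_integral_linear[OF V.J_has_integral[of u t] bounded_linear_beta[OF lam]]
          by (simp add: o_def)
        have int_const: "((\<lambda>s. beta lam u) has_integral t * beta lam u) {0..t}"
          using has_integral_const_real[of "beta lam u" 0 t] t by simp
        have "t * beta lam u \<le> beta lam (V.J t u)"
          by (rule has_integral_le[OF int_const int_V mono]) simp
        then have "lam * (t * beta lam u) \<le> lam * beta lam (V.J t u)"
          using lam by simp
        then have "beta lam u * (1 + lam * t) \<le> beta lam (V t u)"
          using beta_V[OF t] by (simp add: algebra_simps)
        also have "\<dots> \<le> norm u"
          using beta_le[OF lam G.V_nonneg[OF t u]] G.norm_V_le[OF t u] by simp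
        finally show ?thesis .
      qed
      show ?thesis
      proof (rule ccontr)
        assume "beta lam u \<noteq> 0"
        then have pos: "0 < beta lam u"
          using beta_nonneg[OF lam u] by simp
        \<comment> \<open>The time is chosen so that the left side of \<open>growth\<close> exceeds
          \<open>norm u\<close> by exactly \<open>beta lam u\<close>.\<close>
        have "beta lam u * (1 + lam * (norm u / (lam * beta lam u))) = beta lam u + norm u"
          using pos lam by (simp add: field_simps)
        then show False
          using growth[of "norm u / (lam * beta lam u)"] pos lam by simp
      qed
    qed
    show "\<forall>u. beta lam u = 0"
    proof
      fix u :: 'a
      obtain v w where "0 \<le> v" "0 \<le> w" "u = v - w"
        using generating_cone by blast
      then show "beta lam u = 0"
        using linear_beta[OF lam] by (simp add: linear_diff cone)
    qed
  next
    assume beta: "\<forall>u. beta lam u = 0"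
    show "honest DA A B V DG G"
      unfolding honest_def
    proof (intro allI impI)
      fix t :: real and u :: 'a assume "0 \<le> t" "0 \<le> u"
      then show "norm (V t u) - norm u = - abar DA A B DG G (integral {0..t} (\<lambda>s. V s u))"
        by (rule iffD2[OF equiv]) (simp add: b_def beta)
    qed
  qed
qed

end

section \<open>Ergodic theory\<close>

lemma cesaro_tendsto_0:
  fixes f :: "nat \<Rightarrow> 'a::real_normed_vector"
  assumes "f \<longlonglongrightarrow> 0"
  shows "(\<lambda>n. (1 / real n) *\<^sub>R (\<Sum>k<n. f k)) \<longlonglongrightarrow> 0"
proof (rule LIMSEQ_I)
  fix e :: real assume e: "0 < e"
  obtain N where N: "\<And>n. n \<ge> N \<Longrightarrow> norm (f n) < e / 2"
    using LIMSEQ_D[OF assms, of "e / 2"] e by auto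
  define c where "c = (\<Sum>k<N. norm (f k))"
  have sum_le: "norm (\<Sum>k<n. f k) \<le> c + real n * (e / 2)" for n
  proof -
    have "(\<Sum>k<n. norm (f k)) \<le> c + real n * (e / 2)"
    proof (induction n)
      case (Suc n)
      show ?case
      proof (cases "n < N")
        case True
        then have "(\<Sum>k<Suc n. norm (f k)) \<le> c"
          unfolding c_def by (intro sum_mono2) auto
        then show ?thesis
          using e by (simp add: add_increasing2)
      next
        case False
        then show ?thesis
          using Suc N[of n] by (simp add: algebra_simps add_divide_distrib)
      qed
    qed (use e in \<open>simp add: c_def sum_nonneg\<close>)
    then show ?thesis
      using norm_sum[of f "{..<n}"] by linarith
  qed
  \<comment> \<open>Beyond \<open>2 * c / e\<close> the first \<open>N\<close> terms contribute less
    than \<open>e / 2\<close> to the mean.\<close>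
  obtain m :: nat where m: "2 * c / e < real m"
    using reals_Archimedean2 by blast
  have "norm ((1 / real n) *\<^sub>R (\<Sum>k<n. f k) - 0) < e" if "n \<ge> Suc m" for n
  proof -
    have n: "0 < real n" "2 * c / e < real n"
      using that m by auto
    then have "c < real n * (e / 2)"
      using e by (simp add: field_simps)
    then have "norm (\<Sum>k<n. f k) < real n * e"
      using sum_le[of n] by simp
    then show ?thesis
      using n(1) by (simp add: field_simps)
  qed
  then show "\<exists>m. \<forall>n\<ge>m. norm ((1 / real n) *\<^sub>R (\<Sum>k<n. f k) - 0) < e"
    by blast
qed

text \<open>The topology is the pullback along \<open>blinfun_apply\<close> of the product topology,
  where convergence is componentwise.\<close>

lemma limitin_strong_operator_topology_iff:
  "limitin strong_operator_topology f l F \<longleftrightarrow> (\<forall>x. ((\<lambda>n. blinfun_apply (f n) x) \<longlongrightarrow> blinfun_apply l x) F)"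
proof
  assume lim: "limitin strong_operator_topology f l F"
  show "\<forall>x. ((\<lambda>n. blinfun_apply (f n) x) \<longlongrightarrow> blinfun_apply l x) F"
    using continuous_map_limit[OF strong_operator_topology_continuous_evaluation lim]
    by (simp add: o_def)
next
  assume *: "\<forall>x. ((\<lambda>n. blinfun_apply (f n) x) \<longlongrightarrow> blinfun_apply l x) F"
  have "limitin euclidean (\<lambda>n. blinfun_apply (f n)) (blinfun_apply l) F"
    unfolding euclidean_product_topology[symmetric] limitin_componentwise using * by simp
  then have "\<forall>U. open U \<and> blinfun_apply l \<in> U \<longrightarrow> eventually (\<lambda>n. blinfun_apply (f n) \<in> U) F"
    by (simp add: limitin_def)
  then show "limitin strong_operator_topology f l F"
    by (auto simp: limitin_def strong_operator_topology_def openin_pullback_topology topspace_pullback_topology)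
qed

lemma blinfun_power_apply:
  fixes T :: "'a::real_normed_vector \<Rightarrow>\<^sub>L 'a"
  shows "blinfun_apply ((((o\<^sub>L) T) ^^ k) id_blinfun) u = (blinfun_apply T ^^ k) u"
  by (induction k) auto

lemma cesaro_mean_apply:
  assumes "bounded_linear T"
  shows "blinfun_apply (cesaro_mean (Blinfun T) n) u = (1 / real n) *\<^sub>R (\<Sum>k<n. (T ^^ k) u)"
  by (simp add: cesaro_mean_def blinfun.scaleR_left blinfun.sum_left blinfun_power_apply
      bounded_linear_Blinfun_apply[OF assms])

lemma id_minus_cesaro_mean:
  fixes T :: "'a::real_vector \<Rightarrow> 'a"
  assumes "linear T"
  shows "(1 / real n) *\<^sub>R (\<Sum>k<n. (T ^^ k) u) - T ((1 / real n) *\<^sub>R (\<Sum>k<n. (T ^^ k) u))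
    = (1 / real n) *\<^sub>R (u - (T ^^ n) u)"
proof -
  have "(\<Sum>k<n. (T ^^ k) u) - T (\<Sum>k<n. (T ^^ k) u) = u - (T ^^ n) u"
    using sum_lessThan_telescope'[of "\<lambda>k. (T ^^ k) u" n]
    by (simp add: linear_sum[OF assms] sum_subtractf)
  then show ?thesis
    by (simp add: linear_scale[OF assms] flip: scaleR_diff_right)
qed

text \<open>The left side is the average of $u - T^k u$ over $k < n$, and each of these is $I - T$
  applied to the partial sum of $T^j u$ over $j < k$; \<open>x\<close> averages the partial
  sums.\<close>

lemma minus_cesaro_mean_in_range:
  fixes T :: "'a::real_vector \<Rightarrow> 'a"
  assumes T: "linear T" and n: "0 < n"
  shows "\<exists>x. u - (1 / real n) *\<^sub>R (\<Sum>k<n. (T ^^ k) u) = x - T x"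
proof -
  define x where "x = (1 / real n) *\<^sub>R (\<Sum>k<n. \<Sum>j<k. (T ^^ j) u)"
  have "x - T x = (1 / real n) *\<^sub>R (\<Sum>k<n. (\<Sum>j<k. (T ^^ j) u) - T (\<Sum>j<k. (T ^^ j) u))"
    by (simp add: x_def linear_scale[OF T] linear_sum[OF T] sum_subtractf scaleR_diff_right)
  also have "\<dots> = (1 / real n) *\<^sub>R (\<Sum>k<n. u - (T ^^ k) u)"
  proof -
    have "(\<Sum>j<k. (T ^^ j) u) - T (\<Sum>j<k. (T ^^ j) u) = u - (T ^^ k) u" for k
      using sum_lessThan_telescope'[of "\<lambda>k. (T ^^ k) u" k]
      by (simp add: linear_sum[OF T] sum_subtractf)
    then show ?thesis by simp
  qed
  also have "\<dots> = u - (1 / real n) *\<^sub>R (\<Sum>k<n. (T ^^ k) u)"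
    using n by (simp add: sum_subtractf scaleR_diff_right sum_constant_scaleR)
  finally show ?thesis
    by metis
qed

section \<open>Ergodicity of $BR(lam,A)$\<close>

context kato
begin

text \<open>The powers are uniformly bounded, so $I - K$ sends the means to a null sequence and the
  limit is a fixed point of $K$.\<close>

lemma cesaro_limit_eq_0:
  assumes lam: "0 < lam"
    and lim: "(\<lambda>n. (1 / real n) *\<^sub>R (\<Sum>k<n. (K lam ^^ k) u)) \<longlonglongrightarrow> v"
  shows "v = 0"
proof (rule K_fixed_eq_0[OF lam])
  let ?C = "\<lambda>n. (1 / real n) *\<^sub>R (\<Sum>k<n. (K lam ^^ k) u)"
  obtain M where M: "\<And>n u. norm ((K lam ^^ n) u) \<le> M * norm u"
    using K_power_bound[OF lam] by auto
  have "(\<lambda>n. ?C n - K lam (?C n)) \<longlonglongrightarrow> 0"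
    unfolding id_minus_cesaro_mean[OF linear_K[OF lam]]
  proof (rule Lim_null_comparison)
    have "norm ((1 / real n) *\<^sub>R (u - (K lam ^^ n) u)) \<le> 1 / real n * (norm u + M * norm u)" for n
      using norm_triangle_ineq4[of u "(K lam ^^ n) u"] M[of n u]
      by (auto intro!: divide_right_mono)
    then show "\<forall>\<^sub>F n in sequentially. norm ((1 / real n) *\<^sub>R (u - (K lam ^^ n) u))
        \<le> 1 / real n * (norm u + M * norm u)"
      by simp
    show "(\<lambda>n. 1 / real n * (norm u + M * norm u)) \<longlonglongrightarrow> 0"
      by (intro tendsto_mult_left_zero lim_1_over_n)
  qed
  moreover have "(\<lambda>n. ?C n - K lam (?C n)) \<longlonglongrightarrow> v - K lam v"
    by (intro tendsto_diff lim bounded_linear.tendsto[OF bounded_linear_K[OF lam] lim])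
  ultimately show "K lam v = v"
    using LIMSEQ_unique by fastforce
qed

lemma mean_ergodic_iff_beta_eq_0:
  assumes lam: "0 < lam"
  shows "mean_ergodic (K lam) \<longleftrightarrow> (\<forall>u. beta lam u = 0)"
proof
  assume "mean_ergodic (K lam)"
  then obtain P where P: "\<forall>u. (\<lambda>n. (1 / real n) *\<^sub>R (\<Sum>k<n. (K lam ^^ k) u)) \<longlonglongrightarrow> blinfun_apply P u"
    unfolding mean_ergodic_def limitin_strong_operator_topology_iff
    by (auto simp: cesaro_mean_apply)
  have "beta lam u = 0" for u
  proof -
    have beta_power: "beta lam ((K lam ^^ k) u) = beta lam u" for k
      by (induction k) (auto simp: beta_K[OF lam])
    have "(\<lambda>n. (1 / real n) *\<^sub>R (\<Sum>k<n. (K lam ^^ k) u)) \<longlonglongrightarrow> 0"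
      using spec[OF P, of u] cesaro_limit_eq_0[OF lam spec[OF P, of u]] by simp
    then have "(\<lambda>n. beta lam ((1 / real n) *\<^sub>R (\<Sum>k<n. (K lam ^^ k) u))) \<longlonglongrightarrow> 0"
      using bounded_linear.tendsto_zero[OF bounded_linear_beta[OF lam]] by blast
    \<comment> \<open>The index 0 is excluded: there the mean is 0, whatever
      \<open>beta lam u\<close> is.\<close>
    moreover have "\<forall>\<^sub>F n in sequentially. beta lam ((1 / real n) *\<^sub>R (\<Sum>k<n. (K lam ^^ k) u)) = beta lam u"
      using linear_beta[OF lam]
      by (intro eventually_sequentiallyI[of 1]) (simp add: linear_scale linear_sum beta_power)
    ultimately have "(\<lambda>n::nat. beta lam u) \<longlonglongrightarrow> 0"
      by (rule Lim_transform_eventually)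
    then show ?thesis
      by (simp add: LIMSEQ_const_iff)
  qed
  then show "\<forall>u. beta lam u = 0"
    by blast
next
  assume beta: "\<forall>u. beta lam u = 0"
  \<comment> \<open>On the cone Psi is the norm, so the vanishing limit of Psi along the powers is
    norm convergence.\<close>
  have cone: "(\<lambda>n. (K lam ^^ n) u) \<longlonglongrightarrow> 0" if "0 \<le> u" for u
    using beta_LIMSEQ[OF lam, of u] beta that
    by (simp add: Psi_nonneg K_power_nonneg[OF lam] tendsto_norm_zero_iff)
  have "(\<lambda>n. (K lam ^^ n) u) \<longlonglongrightarrow> 0" for u
  proof -
    obtain v w where "0 \<le> v" "0 \<le> w" "u = v - w"
      using generating_cone by blast
    then show ?thesis
      using tendsto_diff[OF cone[of v] cone[of w]] by (simp add: linear_diff[OF linear_K_power[OF lam]])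
  qed
  then have "limitin strong_operator_topology (cesaro_mean (Blinfun (K lam))) 0 sequentially"
    unfolding limitin_strong_operator_topology_iff
    by (simp add: cesaro_mean_apply bounded_linear_K[OF lam] cesaro_tendsto_0)
  then show "mean_ergodic (K lam)"
    using bounded_linear_K[OF lam] by (auto simp: mean_ergodic_def)
qed

section \<open>Uniform ergodicity and the domain of \<open>G\<close>\<close>

lemma operator_eq_iff: "operator_eq DG G DA (\<lambda>u. A u + B u) \<longleftrightarrow> DG \<subseteq> DA"
  using DA_subset G_eq by (auto simp: operator_eq_def)

lemma uniformly_ergodic_if_domain_eq:
  assumes lam: "0 < lam" and sub: "DG \<subseteq> DA"
  shows "uniformly_ergodic (K lam)"
proof -
  have "bounded_linear (\<lambda>x. x - K lam x)"
    by (intro bounded_linear_sub bounded_linear_ident bounded_linear_K lam)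
  \<comment> \<open>The preimage is $(lam - A)R(lam,G)w$, because $(I - K)(lam - A) = lam - A - B =
    lam - G$ on the common domain.\<close>
  moreover have "\<exists>x. x - K lam x = w" for w
  proof
    have "RG lam w \<in> DA"
      using sub G.resolvent_in_domain[OF lam] by blast
    then show "(lam *\<^sub>R RG lam w - A (RG lam w)) - K lam (lam *\<^sub>R RG lam w - A (RG lam w)) = w"
      using G.resolvent_right_inverse[OF lam, of w]
      by (simp add: K_def A.resolvent_left_inverse[OF lam] G_eq diff_diff_eq)
  qed
  ultimately have "\<exists>M>0. \<forall>w. \<exists>x\<in>UNIV. x - K lam x = w \<and> norm x \<le> M * norm w"
    by (intro cone_open_mapping) auto
  then obtain M where M: "M > 0" "\<And>w. \<exists>x. x - K lam x = w \<and> norm x \<le> M * norm w"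
    by auto
  obtain M' where M': "M' > 0" "\<And>n u. norm ((K lam ^^ n) u) \<le> M' * norm u"
    using K_power_bound[OF lam] by auto
  \<comment> \<open>For \<open>n = 0\<close> both sides are 0, as \<open>1 / 0 = 0\<close>.\<close>
  have "norm (cesaro_mean (Blinfun (K lam)) n) \<le> 1 / real n * (M * (1 + M'))" for n
  proof (rule norm_blinfun_bound)
    show "0 \<le> 1 / real n * (M * (1 + M'))"
      using M M' by simp
    fix u
    let ?c = "(1 / real n) *\<^sub>R (\<Sum>k<n. (K lam ^^ k) u)"
    obtain x where x: "x - K lam x = (1 / real n) *\<^sub>R (u - (K lam ^^ n) u)"
      "norm x \<le> M * norm ((1 / real n) *\<^sub>R (u - (K lam ^^ n) u))"
      using M(2) by blast
    have "x - K lam x = ?c - K lam ?c"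
      using x(1) id_minus_cesaro_mean[OF linear_K[OF lam], of n u] by simp
    \<comment> \<open>\<open>x\<close> and the mean have the same image under $I - K$, which is
      injective by \<open>K_fixed_eq_0\<close>; the mean therefore inherits the bound on
      \<open>x\<close>.\<close>
    then have "K lam (x - ?c) = x - ?c"
      by (simp only: linear_diff[OF linear_K[OF lam]]) (simp add: algebra_simps)
    then have "?c = x"
      using K_fixed_eq_0[OF lam, of "x - ?c"] by simp
    moreover have "norm (u - (K lam ^^ n) u) \<le> (1 + M') * norm u"
      using norm_triangle_ineq4[of u "(K lam ^^ n) u"] M'(2)[of n u] by (simp add: algebra_simps)
    then have "M * norm ((1 / real n) *\<^sub>R (u - (K lam ^^ n) u)) \<le> M * (1 / real n * ((1 + M') * norm u))"
      using M(1) by (intro mult_left_mono) (auto intro!: divide_right_mono)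
    ultimately show "norm (blinfun_apply (cesaro_mean (Blinfun (K lam)) n) u)
        \<le> 1 / real n * (M * (1 + M')) * norm u"
      using x(2) by (simp add: cesaro_mean_apply bounded_linear_K[OF lam] mult.assoc)
  qed
  then have "cesaro_mean (Blinfun (K lam)) \<longlonglongrightarrow> 0"
    by (intro Lim_null_comparison[OF _ tendsto_mult_left_zero[OF lim_1_over_n, of "M * (1 + M')"]]) auto
  then show ?thesis
    using bounded_linear_K[OF lam] by (auto simp: uniformly_ergodic_def convergent_def)
qed

lemma domain_eq_if_uniformly_ergodic:
  assumes lam: "0 < lam" and erg: "uniformly_ergodic (K lam)"
  shows "DG \<subseteq> DA"
proof -
  let ?C = "cesaro_mean (Blinfun (K lam))"
  obtain P where P: "?C \<longlonglongrightarrow> P"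
    using erg by (auto simp: uniformly_ergodic_def convergent_def)
  have "blinfun_apply P u = 0" for u
  proof (rule cesaro_limit_eq_0[OF lam])
    have "(\<lambda>n. blinfun_apply (?C n) u) \<longlonglongrightarrow> blinfun_apply P u"
      by (intro blinfun.tendsto P tendsto_const)
    then show "(\<lambda>n. (1 / real n) *\<^sub>R (\<Sum>k<n. (K lam ^^ k) u)) \<longlonglongrightarrow> blinfun_apply P u"
      by (simp add: cesaro_mean_apply bounded_linear_K[OF lam])
  qed
  then have "?C \<longlonglongrightarrow> 0"
    using P by (metis blinfun_eqI zero_blinfun.rep_eq)
  then obtain N where N: "\<And>n. n \<ge> N \<Longrightarrow> norm (?C n) < 1 / 2"
    using LIMSEQ_D[of ?C 0 "1 / 2"] by auto
  define n where "n = Suc N"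
  have n: "0 < n" "norm (?C n) \<le> 1 / 2"
    using N[of n] by (auto simp: n_def)
  have surj: "\<exists>x. x - K lam x = w" for w
  proof -
    \<comment> \<open>The fixed point \<open>y\<close> satisfies \<open>w = y - ?C n y\<close>,
      which lies in the range of $I - K$.\<close>
    have "\<exists>!y. w + ?C n y = y"
    proof (rule banach_fix_type[of "1 / 2"])
      have "norm (?C n (x - y)) \<le> 1 / 2 * norm (x - y)" for x y
        using norm_blinfun[of "?C n" "x - y"] mult_right_mono[OF n(2), of "norm (x - y)"] by simp
      then show "\<forall>x y. dist (w + ?C n x) (w + ?C n y) \<le> 1 / 2 * dist x y"
        by (simp add: dist_norm blinfun.diff_right)
    qed auto
    then obtain y where "w + ?C n y = y"
      by blast
    then have "w = y - ?C n y"
      by (metis add_diff_cancel_right')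
    then show ?thesis
      using minus_cesaro_mean_in_range[OF linear_K[OF lam] n(1), of y]
      by (auto simp: cesaro_mean_apply[OF bounded_linear_K[OF lam]] intro: sym)
  qed
  show ?thesis
  proof
    fix v assume v: "v \<in> DG"
    \<comment> \<open>Since $(lam - G)R(lam,A)x = (I - K)x$, injectivity of $lam - G$ identifies
      \<open>v\<close> with \<open>R lam x\<close>.\<close>
    obtain x where x: "x - K lam x = lam *\<^sub>R v - G v"
      using surj by blast
    have R: "R lam x \<in> DA"
      by (rule A.resolvent_in_domain[OF lam])
    then have "R lam x \<in> DG"
      using DA_subset by (rule subsetD[rotated])
    moreover have "lam *\<^sub>R R lam x - G (R lam x) = x - K lam x"
      using A.resolvent_right_inverse[OF lam, of x] by (simp add: G_eq[OF R] K_def algebra_simps)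
    ultimately have "RG lam (x - K lam x) = R lam x"
      by (rule G.resolvent_eqI[OF lam])
    then have "v = R lam x"
      using G.resolvent_left_inverse[OF lam v] by (simp add: x)
    then show "v \<in> DA"
      using R by simp
  qed
qed

end

theorem theorem3p1:
  fixes A B G :: "'a::abstract_state_space \<Rightarrow> 'a"
    and DA DB DG :: "'a set"
    and V :: "real \<Rightarrow> 'a \<Rightarrow>\<^sub>L 'a"
  assumes "kato_conditions DA A DB B"
    and "kato_semigroup DA A B V DG G"
  shows "(honest DA A B V DG G \<longleftrightarrow>
           (\<exists>lam>0. mean_ergodic (\<lambda>u. B (resolvent DA A lam u)))) \<and>
         (operator_eq DG G DA (\<lambda>u. A u + B u) \<longleftrightarrow>
           (\<exists>lam>0. uniformly_ergodic (\<lambda>u. B (resolvent DA A lam u))))"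
proof -
  interpret kato A B G DA DB DG V
    using assms by unfold_locales
  have K: "(\<lambda>u. B (resolvent DA A lam u)) = K lam" for lam
    by (simp add: K_def fun_eq_iff)
  have "honest DA A B V DG G \<longleftrightarrow> mean_ergodic (K lam)" if "0 < lam" for lam
    using honest_iff_beta_eq_0[OF that] mean_ergodic_iff_beta_eq_0[OF that] by simp
  \<comment> \<open>The equivalence holds for each positive \<open>lam\<close> separately, so the
    witness 1 serves when existence is to be shown.\<close>
  then have "honest DA A B V DG G \<longleftrightarrow> (\<exists>lam>0. mean_ergodic (K lam))"
    by (metis zero_less_one)
  moreover have "operator_eq DG G DA (\<lambda>u. A u + B u) \<longleftrightarrow> (\<exists>lam>0. uniformly_ergodic (K lam))"
    unfolding operator_eq_iff
    using uniformly_ergodic_if_domain_eq[of 1] domain_eq_if_uniformly_ergodic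
    by (metis zero_less_one)
  ultimately show ?thesis
    by (simp add: K)
qed

end
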